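(* For every integer $n\geq 4$, put $\delta=1/(4n)$. There exist $\tau>0$, $\lambda>1+\tau$, $0<\eta<\delta$, and $\epsilon_0>0$ with the following property. Define on $\mathbb{R}^n$ \[ F(y)=\chi_{U_\delta}(y)+\chi_{\{\lambda-\tau<\|y\|<\lambda+\tau\}}(y),\qquad U_\delta=\{y\in\mathbb{R}^n:\delta<\|y\|<1\}, \] and \[ h_n=\frac12\chi_{B_{\eta/2}}-\frac{1}{2(2^n-1)}\chi_{B_\eta\setminus B_{\eta/2}},\qquad B_s=B(0,s). \] For every $0<\epsilon\leq\epsilon_0$, the functions \[ f(y)=F(y)+\epsilon\bigl(e^{-\|y\|}+h_n(y)\bigr),\qquad g(y)=F(y)+\epsilon\bigl(e^{-\|y\|}-h_n(y)\bigr) \] are bounded, radial, strictly positive, and integrable on $\mathbb{R}^n$. Moreover, \[ M_cf(X)=M_cg(X)\quad\text{for every }X\in\mathbb{R}^n,\qquad \|f-g\|_1=2\epsilon c_n\left(\frac{\eta}{2}\right)^n>0. \]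
   Context: $B(x,r)=\{y\in\mathbb{R}^n:\|x-y\|<r\}$ is the open Euclidean ball, $|E|$ is Lebesgue measure, and $c_n=\pi^{n/2}/\Gamma(\frac n2+1)$ is the volume of the unit ball of $\mathbb{R}^n$. For $f\in L^1_{\mathrm{loc}}(\mathbb{R}^n)$, the central Hardy--Littlewood maximal function is $M_cf(x)=\sup_{r>0}\frac{1}{|B(x,r)|}\int_{B(x,r)}|f(t)|\,dt$. $\chi_A$ denotes the characteristic function of $A$. *)

theory Defs
  imports "HOL-Analysis.Analysis"
begin

text \<open>
  The maximal function takes values in \<^typ>\<open>ennreal\<close>, since for a general locally
  integrable function the supremum may be infinite.
\<close>

definition central_maximal :: "('a::euclidean_space \<Rightarrow> real) \<Rightarrow> 'a \<Rightarrow> ennreal"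
  where "central_maximal f x =
    (SUP r\<in>{0<..}. (\<integral>\<^sup>+ t\<in>ball x r. ennreal \<bar>f t\<bar> \<partial>lebesgue) / emeasure lebesgue (ball x r))"

definition L1_norm :: "('a::euclidean_space \<Rightarrow> real) \<Rightarrow> real"
  where "L1_norm f = (\<integral>x. \<bar>f x\<bar> \<partial>lebesgue)"

definition radial :: "('a::real_normed_vector \<Rightarrow> 'b) \<Rightarrow> bool"
  where "radial f \<longleftrightarrow> (\<forall>x y. norm x = norm y \<longrightarrow> f x = f y)"

definition two_shells :: "real \<Rightarrow> real \<Rightarrow> real \<Rightarrow> 'a::real_normed_vector \<Rightarrow> real"
  where "two_shells \<delta> \<tau> \<Lambda> y =
    indicator {y. \<delta> < norm y \<and> norm y < 1} y +
    indicator {y. \<Lambda> - \<tau> < norm y \<and> norm y < \<Lambda> + \<tau>} y"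

definition bump :: "real \<Rightarrow> 'a::euclidean_space \<Rightarrow> real"
  where "bump \<eta> y =
    1 / 2 * indicator (ball 0 (\<eta> / 2)) y -
    1 / (2 * (2 ^ DIM('a) - 1)) * indicator (ball 0 \<eta> - ball 0 (\<eta> / 2)) y"

end

theory Submission
  imports Defs
begin

text \<open>
  Since \<open>h\<^sub>n\<close> has mean zero, \<open>f\<close> and \<open>g\<close> have the same average over \<open>B(X, r)\<close> unless
  \<open>\<bar>r - \<parallel>X\<parallel>\<bar> < \<eta>\<close>. Hence it is enough that for every \<open>X\<close> some radius away from \<open>\<parallel>X\<parallel>\<close> gives \<open>F\<close> a
  larger average than all radii near \<open>\<parallel>X\<parallel>\<close>, by a margin that a small \<open>\<epsilon>\<close> cannot close. For large
  \<open>\<parallel>X\<parallel>\<close> the smallest ball containing both shells does this; on the remaining compact range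
  continuity reduces the claim to a pointwise one: for each \<open>R > 0\<close> and \<open>\<parallel>X\<parallel> = R\<close>, the average of \<open>F\<close>
  over \<open>B(X, r)\<close> is not maximal at \<open>r = R\<close>.

  If \<open>X\<close> lies in one of the shells, small balls have average \<open>1\<close>; if \<open>R \<le> \<delta>\<close>, take \<open>r = 1 - R\<close>.
  Otherwise one shows that the derivative in \<open>r\<close> at \<open>r = R\<close> is not zero. Volumes of lenses are explicit,
  and for a centred ball of radius \<open>s\<close> the derivative is a positive multiple of \<open>s\<^sup>n P(s / (2 R))\<close>,
  where \<open>P(1) = 0\<close> and \<open>P'(x)\<close> has the sign of \<open>n x\<^sup>2 - 1\<close>. So the derivative coming from \<open>U\<^sub>\<delta>\<close>
  has exactly one zero \<open>R\<^sub>0 > 1\<close>, and it is a simple one. The intermediate value theorem gives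
  a thin second shell, centred at a radius \<open>\<Lambda>\<close> near \<open>R\<^sub>0\<close>, such that the derivative of the total average
  vanishes at \<open>R = \<Lambda>\<close> only, which is inside that shell.
\<close>

section \<open>Spherical caps and the sign of the radial derivative\<close>

text \<open>
  This is \<open>(1 - u\<^sup>2)\<^bsup>(n - 1) / 2\<^esup>\<close> on \<open>[-1, 1]\<close>, extended by zero so that the antiderivative \<open>cap\<close> is
  continuously differentiable on all of \<open>\<real>\<close> and one lens formula covers the degenerate configurations.
\<close>

definition profile :: "nat \<Rightarrow> real \<Rightarrow> real"
  where "profile n u = sqrt (max 0 (1 - u\<^sup>2)) ^ (n - 1)"

text \<open>The integral of \<open>profile\<close> from \<open>x\<close> to 1: for n >= 2, the
  volume of the part of the unit ball at height above \<open>x\<close>, divided by the volume of the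
  (n-1)-dimensional unit ball; see \<open>measure_unit_cap\<close>.\<close>

definition cap :: "nat \<Rightarrow> real \<Rightarrow> real"
  where "cap n x = - (LBINT u=ereal 1..ereal x. profile n u)"

lemma profile_nonneg: "profile n u \<ge> 0"
  by (simp add: profile_def)

lemma profile_le_1: "profile n u \<le> 1"
  unfolding profile_def by (intro power_le_one) (auto simp: real_le_lsqrt)

lemma profile_pos: "\<bar>u\<bar> < 1 \<Longrightarrow> profile n u > 0"
  unfolding profile_def by (auto simp: abs_square_less_1)

lemma profile_eq_0: "n \<ge> 2 \<Longrightarrow> \<bar>u\<bar> \<ge> 1 \<Longrightarrow> profile n u = 0"
  using abs_le_square_iff[of 1 u] by (simp add: profile_def max_def)

lemma continuous_on_profile [continuous_intros]:
  "continuous_on S f \<Longrightarrow> continuous_on S (\<lambda>x. profile n (f x))"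
  unfolding profile_def by (intro continuous_intros)

lemma profile_has_derivative:
  assumes "\<bar>x\<bar> < 1"
  shows "(profile n has_real_derivative (- real (n - 1) * x * profile n x / (1 - x\<^sup>2))) (at x)"
proof -
  have pos: "1 - x\<^sup>2 > 0" using assms by (simp add: abs_square_less_1)
  have "((\<lambda>x. sqrt (1 - x\<^sup>2) ^ (n - 1)) has_real_derivative
      (- real (n - 1) * x * sqrt (1 - x\<^sup>2) ^ (n - 1) / (1 - x\<^sup>2))) (at x)"
  proof (cases "n \<le> 1")
    case True
    then show ?thesis by simp
  next
    case False
    then obtain m where m: "n - 1 = Suc m" by (cases "n - 1") auto
    have "((\<lambda>x. sqrt (1 - x\<^sup>2) ^ (n - 1)) has_real_derivative
      (real (n - 1) * (sqrt (1 - x\<^sup>2) ^ (n - 1 - 1) * (- 2 * x * inverse (sqrt (1 - x\<^sup>2)) / 2)))) (at x)"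
      using pos by (auto intro!: derivative_eq_intros)
    moreover have "real (n - 1) * (sqrt (1 - x\<^sup>2) ^ (n - 1 - 1) * (- 2 * x * inverse (sqrt (1 - x\<^sup>2)) / 2))
      = - real (n - 1) * x * sqrt (1 - x\<^sup>2) ^ (n - 1) / (sqrt (1 - x\<^sup>2) * sqrt (1 - x\<^sup>2))"
      using pos unfolding m by (simp del: real_sqrt_mult_self add: divide_simps) (simp add: algebra_simps)
    ultimately show ?thesis using pos by simp
  qed
  moreover have "profile n x = sqrt (1 - x\<^sup>2) ^ (n - 1)" using pos by (simp add: profile_def)
  \<comment> \<open>The truncation by \<open>max\<close> is inactive near \<open>x\<close>, so the
    derivative may be computed without it.\<close>
  moreover have "eventually (\<lambda>y. sqrt (1 - y\<^sup>2) ^ (n - 1) = profile n y) (nhds x)"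
  proof -
    have "eventually (\<lambda>y. y \<in> {-1<..<1}) (nhds x)"
      using assms by (intro eventually_nhds_in_open) auto
    then show ?thesis
      by eventually_elim (auto simp: profile_def max_def abs_square_less_1 not_le
        dest: power2_less_imp_less intro!: arg_cong[where f="\<lambda>x. sqrt x ^ _"]
        simp: square_le_1 abs_square_le_1 power_le_one_iff)
  qed
  ultimately show ?thesis using DERIV_cong_ev by fastforce
qed

lemma cap_has_derivative: "(cap n has_real_derivative - profile n x) (at x)"
proof -
  \<comment> \<open>An interval that contains 1 and has \<open>x\<close> in its interior, where the
    derivative within the interval is the full derivative.\<close>
  let ?a = "min x 1 - 1" and ?b = "max x 1 + 1"
  have "((\<lambda>u. LBINT y=ereal 1..ereal u. profile n y) has_vector_derivative profile n x)
      (at x within {?a..?b})"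
    by (rule interval_integral_FTC2) (auto intro!: continuous_intros)
  then have "((\<lambda>u. LBINT y=ereal 1..ereal u. profile n y) has_vector_derivative profile n x) (at x)"
    by (subst (asm) at_within_interior) (auto simp: interior_atLeastAtMost_real)
  then have "((\<lambda>u. LBINT y=ereal 1..ereal u. profile n y) has_real_derivative profile n x) (at x)"
    by (simp add: has_real_derivative_iff_has_vector_derivative)
  then show ?thesis
    unfolding cap_def[abs_def] by (auto intro!: derivative_eq_intros)
qed

lemmas cap_has_derivative_chain [derivative_intros] = DERIV_chain2[OF cap_has_derivative]

lemma isCont_cap: "isCont (cap n) x"
  using cap_has_derivative DERIV_isCont by blast

lemma continuous_on_cap [continuous_intros]:
  "continuous_on S f \<Longrightarrow> continuous_on S (\<lambda>x. cap n (f x))"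
  by (rule continuous_on_compose2[where t=UNIV]) (auto intro!: continuous_at_imp_continuous_on isCont_cap)

lemma cap_1 [simp]: "cap n 1 = 0"
  by (simp add: cap_def)

lemma cap_eq_0:
  assumes "n \<ge> 2" "x \<ge> 1" shows "cap n x = 0"
proof (cases "x = 1")
  case False
  then obtain z where "1 < z" "z < x" "cap n x - cap n 1 = (x - 1) * (- profile n z)"
    using MVT2[of 1 x "cap n" "\<lambda>x. - profile n x"] cap_has_derivative assms by force
  then show ?thesis using assms profile_eq_0[of n z] by simp
qed simp

lemma cap_le:
  assumes "x \<le> 1" shows "cap n x \<le> 1 - x"
proof (cases "x = 1")
  case False
  then obtain z where "cap n 1 - cap n x = (1 - x) * (- profile n z)"
    using MVT2[of x 1 "cap n" "\<lambda>x. - profile n x"] cap_has_derivative assms by force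
  then show ?thesis using assms profile_le_1[of n z] mult_left_le[of "profile n z" "1-x"] by simp
qed simp

text \<open>
  For a centred ball of radius \<open>s\<close>, the derivative of its density in \<open>B(X, r)\<close> at \<open>r = \<parallel>X\<parallel> = R\<close> is
  proportional to \<open>(s / R)\<^bsup>n - 1\<^esup>\<close> times \<open>slope n (s / R)\<close>. The function \<open>P\<close> above is \<open>nslope\<close>.
\<close>

definition slope :: "nat \<Rightarrow> real \<Rightarrow> real"
  where "slope n a = profile n (a / 2) * (1 - a\<^sup>2 / 2) - n * a * cap n (a / 2)"

definition nslope :: "nat \<Rightarrow> real \<Rightarrow> real"
  where "nslope n x = profile n x * (1 - 2 * x\<^sup>2) / (2 * real n * x) - cap n x"

lemma slope_eq_nslope:
  assumes "n \<noteq> 0" "x \<noteq> 0" shows "slope n (2 * x) = 2 * real n * x * nslope n x"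
  using assms by (simp add: slope_def nslope_def field_simps power2_eq_square)

lemma nslope_1: "n \<ge> 2 \<Longrightarrow> nslope n 1 = 0"
  by (simp add: nslope_def profile_eq_0)

lemma slope_0: "slope n 0 = 1"
  by (simp add: slope_def profile_def)

lemma continuous_on_slope [continuous_intros]:
  "continuous_on S f \<Longrightarrow> continuous_on S (\<lambda>x. slope n (f x))"
  unfolding slope_def by (intro continuous_intros) auto

lemma continuous_on_nslope:
  "n > 0 \<Longrightarrow> S \<subseteq> {0<..} \<Longrightarrow> continuous_on S (nslope n)"
  unfolding nslope_def[abs_def] by (auto intro!: continuous_intros)

text \<open>The division by \<open>2 * n * x\<close> isolates \<open>cap\<close> with a constant
  coefficient. Differentiation turns it into \<open>profile\<close>, and what remains is elementary
  with the sign of \<open>n * x\<^sup>2 - 1\<close>.\<close>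

lemma nslope_has_derivative:
  assumes "n > 0" "0 < x" "x < 1"
  shows "(nslope n has_real_derivative
    (profile n x / (1 - x\<^sup>2) * (n * x\<^sup>2 - 1) / (2 * real n * x\<^sup>2))) (at x)"
proof -
  have pos: "1 - x\<^sup>2 > 0" using assms by (simp add: abs_square_less_1)
  have n: "real (n - 1) = real n - 1" using assms by simp
  have "(nslope n has_real_derivative
      ((- real (n - 1) * x * profile n x / (1 - x\<^sup>2) * (1 - 2 * x\<^sup>2)
         + (0 - 2 * (2 * x)) * profile n x) * (2 * real n * x)
       - profile n x * (1 - 2 * x\<^sup>2) * (2 * n)) / (2 * real n * x * (2 * real n * x)) - - profile n x) (at x)"
    unfolding nslope_def[abs_def] using assms
    by (auto intro!: derivative_eq_intros profile_has_derivative cap_has_derivative)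
  moreover have "((- real (n - 1) * x * profile n x / (1 - x\<^sup>2) * (1 - 2 * x\<^sup>2)
         + (0 - 2 * (2 * x)) * profile n x) * (2 * real n * x)
       - profile n x * (1 - 2 * x\<^sup>2) * (2 * n)) / (2 * real n * x * (2 * real n * x)) - - profile n x
    = profile n x / (1 - x\<^sup>2) * (n * x\<^sup>2 - 1) / (2 * real n * x\<^sup>2)"
    unfolding n using assms pos by (simp add: divide_simps) (simp add: algebra_simps power2_eq_square)
  ultimately show ?thesis by simp
qed

text \<open>From \<open>1 / sqrt n\<close> on, \<open>nslope\<close> increases strictly up to its
  value 0 at 1.\<close>

lemma nslope_neg:
  fixes x :: real
  assumes "n \<ge> 2" "1 \<le> n * x\<^sup>2" "0 < x" "x < 1"
  shows "nslope n x < 0"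
proof -
  have "nslope n x < nslope n 1"
  proof (rule DERIV_pos_imp_increasing_open[of x 1 "nslope n"])
    fix z assume z: "x < z" "z < 1"
    then have "x\<^sup>2 < z\<^sup>2" using assms by (intro power_strict_mono) auto
    then have "real n * x\<^sup>2 < real n * z\<^sup>2"
      using assms by (intro mult_strict_left_mono) auto
    then have "n * z\<^sup>2 > 1" using assms by linarith
    moreover have "1 - z\<^sup>2 > 0" using z assms by (simp add: abs_square_less_1)
    moreover have "profile n z > 0" using z assms by (intro profile_pos) auto
    ultimately have "profile n z / (1 - z\<^sup>2) * (n * z\<^sup>2 - 1) / (2 * real n * z\<^sup>2) > 0"
      using z assms by simp
    then show "\<exists>y. DERIV (nslope n) z :> y \<and> 0 < y"
      using nslope_has_derivative[of n z] z assms by fastforce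
  qed (use assms in \<open>auto intro!: continuous_on_nslope\<close>)
  then show ?thesis using nslope_1 assms by simp
qed

text \<open>The first term of \<open>slope\<close> is at least 15/32, and the subtracted one is at
  most 1/4 because \<open>n * a \<le> 1 / 4\<close> and \<open>cap\<close> is at most 1
  here.\<close>

lemma slope_pos_small:
  assumes "n \<ge> 2" "0 \<le> a" "a \<le> 1 / (4 * real n)"
  shows "slope n a > 0"
proof -
  have na: "n * a \<le> 1 / 4" using assms by (simp add: field_simps)
  have a: "a \<le> 1 / 8"
    using assms na mult_right_mono[of 2 "real n" a] by simp
  have "(n * (a/2)) * (a/2) \<le> (1/8) * (1/16)"
    using na a assms by (intro mult_mono) (auto simp: mult.commute)
  then have "n * (a/2)\<^sup>2 \<le> 1 / 16" by (simp add: power2_eq_square)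
  have a2: "(a/2)\<^sup>2 \<le> 1" using a assms by (simp add: power_le_one)
  have "real (n - 1) * (a/2)\<^sup>2 \<le> real n * (a/2)\<^sup>2" by (intro mult_right_mono) auto
  then have "1 - 1/16 \<le> 1 + real (n - 1) * (- (a/2)\<^sup>2)"
    using \<open>n * (a/2)\<^sup>2 \<le> 1 / 16\<close> by simp
  \<comment> \<open>Bernoulli bounds the power of \<open>1 - (a/2)\<^sup>2\<close>, which in turn
    lies below its own square root.\<close>
  also have "\<dots> \<le> (1 + (- (a/2)\<^sup>2)) ^ (n - 1)"
    using a2 by (intro Bernoulli_inequality) auto
  also have "\<dots> \<le> sqrt (max 0 (1 - (a/2)\<^sup>2)) ^ (n - 1)"
  proof (rule power_mono)
    have "(1 - (a/2)\<^sup>2)\<^sup>2 \<le> 1 - (a/2)\<^sup>2"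
      using a2 mult_left_le[of "1 - (a/2)\<^sup>2" "1 - (a/2)\<^sup>2"] by (simp add: power2_eq_square)
    then show "1 + - (a / 2)\<^sup>2 \<le> sqrt (max 0 (1 - (a / 2)\<^sup>2))"
      using a2 by (intro real_le_rsqrt) auto
  qed (use a2 in simp)
  finally have q: "profile n (a/2) \<ge> 15/16" by (simp add: profile_def)
  have "a * a \<le> 1 * 1" using a assms by (intro mult_mono) auto
  then have "1 - a\<^sup>2 / 2 \<ge> 1/2" by (simp add: power2_eq_square)
  then have "profile n (a/2) * (1 - a\<^sup>2 / 2) \<ge> 15/16 * (1/2)"
    using q by (intro mult_mono) auto
  moreover have "n * a * cap n (a/2) \<le> 1/4 * 1"
  proof (cases "cap n (a/2) \<ge> 0")
    case True
    then show ?thesis using na cap_le[of "a/2" n] a assms by (intro mult_mono) auto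
  next
    case False
    then have "n * a * cap n (a/2) \<le> 0" using assms by (intro mult_nonneg_nonpos) auto
    then show ?thesis by simp
  qed
  ultimately show ?thesis by (simp add: slope_def)
qed

section \<open>The sign change of the radial derivative for the first shell\<close>

lemma profile_div:
  assumes "n \<ge> 3" "\<bar>x\<bar> < 1"
  shows "profile n x / (1 - x\<^sup>2) = sqrt (1 - x\<^sup>2) ^ (n - 3)"
proof -
  have pos: "1 - x\<^sup>2 > 0" using assms by (simp add: abs_square_less_1)
  have "n - 1 = (n - 3) + 2" using assms by simp
  then have "sqrt (1 - x\<^sup>2) ^ (n - 1) = sqrt (1 - x\<^sup>2) ^ (n - 3) * (sqrt (1 - x\<^sup>2))\<^sup>2"
    by (simp only: power_add)
  then show ?thesis using pos by (simp add: profile_def)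
qed

text \<open>With \<open>a = 1 / R\<close>, this is the contribution of the unit ball minus that of
  the ball of radius \<delta>, after removal of a positive factor common to all centred
  balls.\<close>

definition "annulus_slope n \<delta> a = slope n a - \<delta> ^ (n - 1) * slope n (\<delta> * a)"

text \<open>The same quantity in the variable \<open>x = a / 2\<close>, divided by
  \<open>2 * n * x\<close> so that the derivative contains no \<open>cap\<close>.\<close>

definition "annulus_nslope n \<delta> x = nslope n x - \<delta> ^ n * nslope n (\<delta> * x)"

lemma annulus_slope_eq:
  assumes "n > 0" "x \<noteq> 0" "\<delta> > 0"
  shows "annulus_slope n \<delta> (2 * x) = 2 * real n * x * annulus_nslope n \<delta> x"
proof -
  have "slope n (\<delta> * (2 * x)) = 2 * real n * (\<delta> * x) * nslope n (\<delta> * x)"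
    using slope_eq_nslope[of n "\<delta> * x"] assms by (simp add: algebra_simps)
  moreover have "\<delta> ^ n = \<delta> * \<delta> ^ (n - 1)" using assms by (cases n) auto
  ultimately show ?thesis
    using slope_eq_nslope[of n x] assms
    by (simp add: annulus_slope_def annulus_nslope_def algebra_simps)
qed

text \<open>The derivative of \<open>annulus_nslope\<close> up to a negative factor: a positive rate
  means that \<open>annulus_nslope\<close> decreases.\<close>

definition "annulus_rate n \<delta> x = sqrt (1 - x\<^sup>2) ^ (n - 3) * (1 - n * x\<^sup>2)
  - \<delta> ^ (n - 1) * (sqrt (1 - (\<delta> * x)\<^sup>2) ^ (n - 3) * (1 - n * (\<delta> * x)\<^sup>2))"

lemma annulus_nslope_has_derivative:
  assumes "n \<ge> 3" "0 < x" "x < 1" "0 < \<delta>" "\<delta> < 1"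
  shows "(annulus_nslope n \<delta> has_real_derivative - annulus_rate n \<delta> x / (2 * real n * x\<^sup>2)) (at x)"
proof -
  have dx: "\<delta> * x < 1" using assms mult_strict_mono[of \<delta> 1 x 1] by simp
  have 1: "(nslope n has_real_derivative (sqrt (1 - x\<^sup>2) ^ (n - 3) * (n * x\<^sup>2 - 1) / (2 * real n * x\<^sup>2))) (at x)"
    using nslope_has_derivative[of n x] profile_div[of n x] assms by simp
  have 2: "(nslope n has_real_derivative
      (sqrt (1 - (\<delta> * x)\<^sup>2) ^ (n - 3) * (n * (\<delta> * x)\<^sup>2 - 1) / (2 * real n * (\<delta> * x)\<^sup>2))) (at (\<delta> * x))"
    using nslope_has_derivative[of n "\<delta> * x"] profile_div[of n "\<delta> * x"] assms dx by simp
  have "((\<lambda>x. nslope n (\<delta> * x)) has_real_derivative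
      (sqrt (1 - (\<delta> * x)\<^sup>2) ^ (n - 3) * (n * (\<delta> * x)\<^sup>2 - 1) / (2 * real n * (\<delta> * x)\<^sup>2)) * \<delta>) (at x)"
    by (rule DERIV_chain2[where g="\<lambda>x. \<delta> * x", OF 2]) (auto intro!: derivative_eq_intros)
  from DERIV_diff[OF 1 DERIV_cmult[OF this, of "\<delta> ^ n"]]
  have "(annulus_nslope n \<delta> has_real_derivative
     (sqrt (1 - x\<^sup>2) ^ (n - 3) * (n * x\<^sup>2 - 1) / (2 * real n * x\<^sup>2)) - \<delta> ^ n *
     ((sqrt (1 - (\<delta> * x)\<^sup>2) ^ (n - 3) * (n * (\<delta> * x)\<^sup>2 - 1) / (2 * real n * (\<delta> * x)\<^sup>2)) * \<delta>)) (at x)"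
    by (simp add: annulus_nslope_def[abs_def])
  moreover have "\<delta> ^ n = \<delta> * \<delta> ^ (n - 1)" using assms by (cases n) auto
  moreover have "(p * (n * x\<^sup>2 - 1) / (2 * real n * x\<^sup>2)) - \<delta> * d *
     ((r * (n * (\<delta> * x)\<^sup>2 - 1) / (2 * real n * (\<delta> * x)\<^sup>2)) * \<delta>)
     = - (p * (1 - n * x\<^sup>2) - d * (r * (1 - n * (\<delta> * x)\<^sup>2))) / (2 * real n * x\<^sup>2)" for p d r :: real
    using assms by (simp add: divide_simps power_mult_distrib) (simp add: algebra_simps power2_eq_square)
  ultimately show ?thesis by (simp add: annulus_rate_def)
qed

text \<open>
  Both factors of the first term, divided by those of the second, decrease in \<open>x\<close>, because
  \<open>(1 - c x\<^sup>2) / (1 - c \<delta>\<^sup>2 x\<^sup>2)\<close> does.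
\<close>

lemma annulus_rate_neg_mono:
  fixes x y :: real
  assumes n: "n \<ge> 3" and x: "0 < x" "x < y" "n * y\<^sup>2 < 1" and \<delta>: "0 < \<delta>" "\<delta> < 1"
    and le: "annulus_rate n \<delta> x \<le> 0"
  shows "annulus_rate n \<delta> y < 0"
proof -
  define u where "u z = sqrt (1 - z\<^sup>2) ^ (n - 3)" for z :: real
  define v where "v z = 1 - n * z\<^sup>2" for z :: real
  have "1 * y\<^sup>2 \<le> real n * y\<^sup>2" using n by (intro mult_right_mono) auto
  then have y2: "y\<^sup>2 < 1" using x by linarith
  have xy: "x\<^sup>2 < y\<^sup>2" using x by (intro power_strict_mono) auto
  have d2: "\<delta>\<^sup>2 < 1" using \<delta> by (simp add: abs_square_less_1)
  have sm: "(\<delta> * z)\<^sup>2 < 1 \<and> n * (\<delta> * z)\<^sup>2 < 1 \<and> z\<^sup>2 < 1 \<and> n * z\<^sup>2 < 1" if "z\<^sup>2 \<le> y\<^sup>2" for z :: real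
  proof -
    have a: "(\<delta> * z)\<^sup>2 \<le> z\<^sup>2"
      using d2 mult_right_mono[of "\<delta>\<^sup>2" 1 "z\<^sup>2"] by (simp add: power_mult_distrib)
    have "n * (\<delta> * z)\<^sup>2 \<le> n * z\<^sup>2" using a by (intro mult_left_mono) auto
    moreover have "n * z\<^sup>2 \<le> n * y\<^sup>2" using that by (intro mult_left_mono) auto
    ultimately show ?thesis using a that x y2 by linarith
  qed
  have pos: "u z > 0" "v z > 0" "u (\<delta> * z) > 0" "v (\<delta> * z) > 0" if "z\<^sup>2 \<le> y\<^sup>2" for z :: real
    using sm[OF that] by (auto simp: u_def v_def)
  have gap: "(y\<^sup>2 - x\<^sup>2) * (1 - \<delta>\<^sup>2) > 0" using xy d2 by simp
  have "(1 - y\<^sup>2) * (1 - (\<delta> * x)\<^sup>2) \<le> (1 - x\<^sup>2) * (1 - (\<delta> * y)\<^sup>2)"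
    using gap by (simp add: algebra_simps power_mult_distrib)
  then have "sqrt ((1 - y\<^sup>2) * (1 - (\<delta> * x)\<^sup>2)) ^ (n - 3) \<le> sqrt ((1 - x\<^sup>2) * (1 - (\<delta> * y)\<^sup>2)) ^ (n - 3)"
    using sm[of x] sm[of y] xy by (intro power_mono real_sqrt_le_mono) auto
  then have 1: "u y * u (\<delta> * x) \<le> u x * u (\<delta> * y)"
    by (simp add: u_def real_sqrt_mult power_mult_distrib)
  have "n * ((y\<^sup>2 - x\<^sup>2) * (1 - \<delta>\<^sup>2)) > 0" using gap n by simp
  then have 2: "v y * v (\<delta> * x) < v x * v (\<delta> * y)"
    by (simp add: v_def algebra_simps power_mult_distrib)
  have "(u y * u (\<delta> * x)) * (v y * v (\<delta> * x)) < (u x * u (\<delta> * y)) * (v x * v (\<delta> * y))"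
    using pos[of x] pos[of y] xy
    by (intro mult_le_less_imp_less[OF 1 2] mult_nonneg_nonneg mult_pos_pos) (simp_all add: less_imp_le)
  also have "\<dots> = (u x * v x) * (u (\<delta> * y) * v (\<delta> * y))" by simp
  \<comment> \<open>The assumption on the rate at \<open>x\<close> enters here. Cancelling the
    positive factor at \<open>\<delta> * x\<close> leaves the inequality at
    \<open>y\<close>.\<close>
  also have "\<dots> \<le> (\<delta> ^ (n - 1) * (u (\<delta> * x) * v (\<delta> * x))) * (u (\<delta> * y) * v (\<delta> * y))"
    using le pos[of y] by (intro mult_right_mono) (auto simp: annulus_rate_def u_def v_def)
  finally have "(u y * v y) * (u (\<delta> * x) * v (\<delta> * x))
      < (\<delta> ^ (n - 1) * (u (\<delta> * y) * v (\<delta> * y))) * (u (\<delta> * x) * v (\<delta> * x))"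
    by (simp add: mult_ac)
  then have "u y * v y < \<delta> ^ (n - 1) * (u (\<delta> * y) * v (\<delta> * y))"
    using pos[of x] xy by (subst (asm) mult_less_cancel_right_pos) auto
  then show ?thesis by (simp add: annulus_rate_def u_def v_def)
qed

text \<open>Before \<open>1 / sqrt n\<close> the rate can change sign only once, from positive to
  negative. As soon as it is not positive, the function increases towards a negative value and hence
  is negative itself. So it decreases strictly until after its first zero and stays negative from
  there on. The range \<open>x \<le> 1 / 2\<close> corresponds to \<open>R \<ge> 1\<close>.\<close>

lemma annulus_nslope_sign:
  assumes n: "n \<ge> 4" and \<delta>: "0 < \<delta>" "\<delta> \<le> 1 / (4 * real n)"
  obtains x0 where "0 < x0" "x0 < 1 / 2" "annulus_nslope n \<delta> x0 = 0" "annulus_rate n \<delta> x0 > 0"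
    "\<And>x. 0 < x \<Longrightarrow> x < x0 \<Longrightarrow> annulus_nslope n \<delta> x > 0"
    "\<And>x. x0 < x \<Longrightarrow> x \<le> 1 / 2 \<Longrightarrow> annulus_nslope n \<delta> x < 0"
proof -
  let ?f = "annulus_nslope n \<delta>" and ?r = "annulus_rate n \<delta>"
  have "1 / (4 * real n) \<le> 1 / 16" using n by (simp add: divide_simps)
  then have \<delta>1: "\<delta> < 1" using \<delta> by simp
  \<comment> \<open>The point where \<open>n * x\<^sup>2 = 1\<close>; it is at most 1/2 because n >=
    4.\<close>
  define b where "b = 1 / sqrt n"
  have b: "b > 0" "n * b\<^sup>2 = 1" "b \<le> 1 / 2"
    using n real_sqrt_le_mono[of 4 "real n"] by (auto simp: b_def power_divide divide_simps)
  \<comment> \<open>Beyond \<open>b\<close> both terms have the right sign: \<open>nslope\<close> is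
    negative at \<open>x\<close>, and positive at \<open>\<delta> * x\<close> since
    \<open>2 * \<delta> * x\<close> is within the range of \<open>slope_pos_small\<close>.\<close>
  have neg: "?f x < 0" if "x > 0" "x \<le> 1 / 2" "n * x\<^sup>2 \<ge> 1" for x :: real
  proof -
    have "\<delta> * x > 0" "\<delta> * (2 * x) \<le> \<delta> * 1" using that \<delta> by (auto intro!: mult_left_mono)
    then have "slope n (2 * (\<delta> * x)) > 0"
      using \<delta> n by (intro slope_pos_small order.trans[OF _ \<delta>(2)]) auto
    then have "0 < 2 * real n * (\<delta> * x) * nslope n (\<delta> * x)"
      using slope_eq_nslope[of n "\<delta> * x"] that \<delta> n by simp
    moreover have "0 < 2 * real n * (\<delta> * x)" using that \<delta> n by simp
    ultimately have "nslope n (\<delta> * x) > 0"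
      by (rule zero_less_mult_pos)
    moreover have "nslope n x < 0" using that n by (intro nslope_neg) auto
    ultimately show ?thesis using \<delta> unfolding annulus_nslope_def
      by (smt (verit) mult_pos_pos zero_less_power)
  qed
  have deriv: "(?f has_real_derivative - ?r x / (2 * real n * x\<^sup>2)) (at x)" if "0 < x" "x < 1" for x :: real
    using that n \<delta> \<delta>1 by (intro annulus_nslope_has_derivative) auto
  have cont: "continuous_on {x..y} ?f" if "0 < x" "y < 1" for x y
    using that by (intro DERIV_continuous_on[OF has_field_derivative_at_within[OF deriv]]) auto
  have dec: "?f y < ?f x" if "0 < x" "x < y" "y < 1" "\<And>z. x < z \<Longrightarrow> z < y \<Longrightarrow> ?r z > 0" for x y
  proof (rule DERIV_neg_imp_decreasing_open[of x y ?f])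
    fix z assume "x < z" "z < y"
    then show "\<exists>w. DERIV ?f z :> w \<and> w < 0"
      using that n by (intro exI[of _ "- ?r z / (2 * real n * z\<^sup>2)"] conjI deriv) auto
  qed (use that in \<open>auto intro!: cont\<close>)
  have inc: "?f x < ?f y" if "0 < x" "x < y" "y < 1" "\<And>z. x < z \<Longrightarrow> z < y \<Longrightarrow> ?r z < 0" for x y
  proof (rule DERIV_pos_imp_increasing_open[of x y ?f])
    fix z assume "x < z" "z < y"
    then show "\<exists>w. DERIV ?f z :> w \<and> w > 0"
      using that n by (intro exI[of _ "- ?r z / (2 * real n * z\<^sup>2)"] conjI deriv)
        (auto intro!: divide_neg_pos)
  qed (use that in \<open>auto intro!: cont\<close>)
  have below: "n * z\<^sup>2 < 1" if "0 < z" "z < b" for z :: real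
  proof -
    have "z\<^sup>2 < b\<^sup>2" using that by (intro power_strict_mono) auto
    then have "n * z\<^sup>2 < n * b\<^sup>2" using n by simp
    then show ?thesis using b by simp
  qed
  \<comment> \<open>Once not positive, the rate is negative up to \<open>b\<close>, so
    \<open>?f\<close> rises to the negative value \<open>?f b\<close>.\<close>
  have tail: "?f x < 0" if "0 < x" "x < b" "?r x \<le> 0" for x
  proof -
    have "?f x < ?f b"
    proof (rule inc)
      fix z assume "x < z" "z < b"
      then show "?r z < 0" using that n \<delta> \<delta>1 below by (intro annulus_rate_neg_mono[of n x z]) auto
    qed (use that b in auto)
    then show ?thesis using neg[of b] b by simp
  qed
  have pos: "?r z > 0" if "?r x > 0" "0 < z" "z \<le> x" "x < b" for x z
    using annulus_rate_neg_mono[of n z x \<delta>] that n \<delta> \<delta>1 below[of x] by (cases "z = x") force+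
  \<comment> \<open>The intermediate value theorem is applied to \<open>annulus_slope\<close>, which
    is continuous and positive at 0, whereas \<open>annulus_nslope\<close> involves a division by
    \<open>x\<close>.\<close>
  have s0: "annulus_slope n \<delta> 0 > 0"
    using \<delta> \<delta>1 n by (simp add: annulus_slope_def slope_0 power_less_one_iff)
  obtain a0 where a0: "0 \<le> a0" "a0 \<le> 2 * b" "annulus_slope n \<delta> a0 = 0"
  proof -
    have "annulus_slope n \<delta> (2 * b) < 0"
      using annulus_slope_eq[of n b \<delta>] neg[of b] b n \<delta> by (simp add: mult_pos_neg)
    moreover have "continuous_on {0..2 * b} (annulus_slope n \<delta>)"
      unfolding annulus_slope_def[abs_def] by (intro continuous_intros)
    ultimately show ?thesis using IVT2'[of "annulus_slope n \<delta>" "2 * b" 0 0] b s0 that by auto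
  qed
  have "a0 \<noteq> 0" using a0 s0 by auto
  moreover have "a0 = 2 * (a0 / 2)" by simp
  ultimately have z: "?f (a0 / 2) = 0" 
    using annulus_slope_eq[of n "a0/2" \<delta>] a0 n \<delta> by auto
  define x0 where "x0 = a0 / 2"
  have x0: "0 < x0" "x0 < b" "?f x0 = 0"
    using a0 \<open>a0 \<noteq> 0\<close> z neg[of b] b by (auto simp: x0_def less_le)
  \<comment> \<open>Otherwise \<open>tail\<close> would make the value at the zero negative. This is
    what makes the zero simple.\<close>
  have r0: "?r x0 > 0" using tail[of x0] x0 by force
  show ?thesis
  proof (rule that[of x0])
    show "?f x > 0" if "0 < x" "x < x0" for x
      using dec[of x x0] pos[OF r0] that x0 b by force
    show "?f x < 0" if "x0 < x" "x \<le> 1 / 2" for x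
    proof (cases "x < b")
      case False
      then have "b\<^sup>2 \<le> x\<^sup>2" using b by (intro power_mono) auto
      then have "n * b\<^sup>2 \<le> n * x\<^sup>2" by (intro mult_left_mono) auto
      then show ?thesis using neg[of x] that x0 b by simp
    next
      case True
      show ?thesis
      proof (cases "?r x \<le> 0")
        case False
        then show ?thesis using dec[of x0 x] pos[of x] that x0 True by force
      qed (use tail that x0 True in auto)
    qed
  qed (use x0 b r0 in auto)
qed

section \<open>Placing the second shell\<close>

text \<open>Left in the shape that the differentiation rules give. Its continuity is what matters;
  the sign needed later comes from uniqueness of derivatives.\<close>

definition slope' :: "nat \<Rightarrow> real \<Rightarrow> real"
  where "slope' n a = - real (n - 1) * (a / 2) * profile n (a / 2) / (1 - (a / 2)\<^sup>2) * (1 / 2) * (1 - a\<^sup>2 / 2)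
    - a * profile n (a / 2) - (n * cap n (a / 2) - profile n (a / 2) * (1 / 2) * (n * a))"

lemma slope_has_derivative:
  assumes "0 < a" "a < 2"
  shows "(slope n has_real_derivative slope' n a) (at a)"
proof -
  have 1: "((\<lambda>a. profile n (a / 2)) has_real_derivative
      - real (n - 1) * (a / 2) * profile n (a / 2) / (1 - (a / 2)\<^sup>2) * (1 / 2)) (at a)"
    using assms by (intro DERIV_chain2[where g="\<lambda>a. a / 2", OF profile_has_derivative])
      (auto intro!: derivative_eq_intros)
  have 2: "((\<lambda>a. cap n (a / 2)) has_real_derivative - profile n (a / 2) * (1 / 2)) (at a)"
    by (auto intro!: derivative_eq_intros)
  show ?thesis unfolding slope_def[abs_def] slope'_def
    by (rule derivative_eq_intros 1 2 refl | simp)+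
qed

lemma continuous_on_slope':
  assumes "S \<subseteq> {0<..<2}"
  shows "continuous_on S (slope' n)"
proof -
  have "1 - (x / 2)\<^sup>2 \<noteq> 0" if "x \<in> S" for x
    using that assms abs_square_less_1[of "x/2"] by fastforce
  then show ?thesis unfolding slope'_def[abs_def]
    by (intro continuous_intros) auto
qed

text \<open>Uniform continuity on a compact box, applied to two points at distance
  \<open>2 * t\<close>.\<close>

lemma uniform_symmetric_difference:
  fixes \<Psi> :: "real \<times> real \<Rightarrow> real"
  assumes "continuous_on ({1 - d..1 + d} \<times> K) \<Psi>" "compact K" "d > 0" "e > 0"
  obtains t0 where "t0 > 0" "t0 \<le> d"
    "\<And>t w. 0 < t \<Longrightarrow> t < t0 \<Longrightarrow> w \<in> K \<Longrightarrow> \<bar>\<Psi> (1 + t, w) - \<Psi> (1 - t, w)\<bar> < e"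
proof -
  have "uniformly_continuous_on ({1 - d..1 + d} \<times> K) \<Psi>"
    using assms by (intro compact_uniformly_continuous compact_Times) auto
  then obtain r where r: "r > 0" "\<And>x y. x \<in> {1 - d..1 + d} \<times> K \<Longrightarrow> y \<in> {1 - d..1 + d} \<times> K \<Longrightarrow>
      dist y x < r \<Longrightarrow> dist (\<Psi> y) (\<Psi> x) < e"
    unfolding uniformly_continuous_on_def using assms by metis
  show ?thesis
  proof (rule that[of "min d (r / 2)"])
    fix t w assume "0 < t" "t < min d (r / 2)" "w \<in> K"
    then show "\<bar>\<Psi> (1 + t, w) - \<Psi> (1 - t, w)\<bar> < e"
      using r(2)[of "(1 - t, w)" "(1 + t, w)"] by (simp add: dist_Pair_Pair dist_real_def real_sqrt_mult)
  qed (use r assms in auto)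
qed

text \<open>
  With \<open>\<Lambda> = 1 / a1\<close> and \<open>\<tau> = t \<Lambda>\<close>, the contribution of the second shell and its derivative in \<open>a\<close> tend
  to zero with \<open>t\<close>, uniformly in \<open>a1\<close> near \<open>a0\<close>. Hence for fixed small \<open>t\<close> the point \<open>a1\<close> can be
  chosen as a zero of the total, which is strictly decreasing near \<open>a0\<close> and nonzero elsewhere.
\<close>

lemma shell_placement:
  fixes k k' L L' :: "real \<Rightarrow> real"
  assumes k: "continuous_on {0..} k"
    and k': "\<And>a. 1/2 \<le> a \<Longrightarrow> a \<le> 3/2 \<Longrightarrow> (k has_real_derivative k' a) (at a)"
      "continuous_on {1/2..3/2} k'"
    and L: "continuous_on {0..1} L"
    and a0: "0 < a0" "a0 < 1"
    and L_sign: "\<And>a. 0 \<le> a \<Longrightarrow> a < a0 \<Longrightarrow> L a > 0" "\<And>a. a0 < a \<Longrightarrow> a \<le> 1 \<Longrightarrow> L a < 0"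
    and L': "\<And>a. 0 < a \<Longrightarrow> a < 1 \<Longrightarrow> (L has_real_derivative L' a) (at a)"
      "continuous_on {0<..<1} L'" "L' a0 < 0"
  obtains \<tau> \<Lambda> where "\<tau> > 0" "\<Lambda> > 1 + \<tau>"
    "\<And>a. 0 < a \<Longrightarrow> a \<le> 1 \<Longrightarrow> \<Lambda> * a \<noteq> 1 \<Longrightarrow>
       L a + (\<Lambda> + \<tau>) ^ m * k ((\<Lambda> + \<tau>) * a) - (\<Lambda> - \<tau>) ^ m * k ((\<Lambda> - \<tau>) * a) \<noteq> 0"
proof -
  \<comment> \<open>Half of the slope of \<open>L\<close> at its zero: near \<open>a0\<close> the
    slope of \<open>L\<close> stays below \<open>-c\<close>, and a perturbation of the slope by less
    than \<open>c\<close> is harmless.\<close>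
  define c where "c = - L' a0 / 2"
  have c: "c > 0" using L' by (simp add: c_def)
  \<comment> \<open>The bound \<open>a0 / 16\<close> keeps \<open>l * a\<close> within 1/4 of 1 for
    all \<open>a\<close> in this neighbourhood, so that \<open>k'\<close> is only evaluated in
    [1/2, 3/2].\<close>
  obtain \<rho> where \<rho>: "\<rho> > 0" "\<rho> \<le> a0 / 16" "a0 + \<rho> < 1"
    "\<And>a. \<bar>a - a0\<bar> \<le> \<rho> \<Longrightarrow> L' a < - c"
  proof -
    have "isCont L' a0"
      using L'(2) a0 by (simp add: continuous_on_eq_continuous_at)
    then obtain r where r: "r > 0" "\<And>x. dist x a0 < r \<Longrightarrow> dist (L' x) (L' a0) < c"
      using c unfolding continuous_at_eps_delta by metis
    show ?thesis
    proof (rule that[of "min (r/2) (min (a0/16) ((1 - a0)/2))"])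
      fix a assume "\<bar>a - a0\<bar> \<le> min (r/2) (min (a0/16) ((1 - a0)/2))"
      then have "\<bar>a - a0\<bar> < r" using r by linarith
      then have "\<bar>L' a - L' a0\<bar> < c" using r(2)[of a] by (simp add: dist_real_def)
      then show "L' a < - c" unfolding c_def by (simp add: abs_less_iff)
    qed (use r a0 in \<open>auto simp: min_def field_simps\<close>)
  qed
  \<comment> \<open>By compactness, \<gamma> is a lower bound of \<open>\<bar>L\<bar>\<close>
    outside the neighbourhood.\<close>
  obtain \<gamma> where \<gamma>: "\<gamma> > 0" "\<And>a. 0 \<le> a \<Longrightarrow> a \<le> a0 - \<rho> \<Longrightarrow> L a \<ge> \<gamma>"
    "\<And>a. a0 + \<rho> \<le> a \<Longrightarrow> a \<le> 1 \<Longrightarrow> L a \<le> - \<gamma>"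
  proof -
    have "\<exists>x\<in>{0..a0-\<rho>}. \<forall>y\<in>{0..a0-\<rho>}. L x \<le> L y"
      using \<rho> a0 by (intro continuous_attains_inf continuous_on_subset[OF L]) auto
    then obtain x where x: "x \<in> {0..a0-\<rho>}" "\<And>y. y \<in> {0..a0-\<rho>} \<Longrightarrow> L x \<le> L y" by blast
    have "\<exists>x\<in>{a0+\<rho>..1}. \<forall>y\<in>{a0+\<rho>..1}. L y \<le> L x"
      using \<rho> a0 by (intro continuous_attains_sup continuous_on_subset[OF L]) auto
    then obtain z where z: "z \<in> {a0+\<rho>..1}" "\<And>y. y \<in> {a0+\<rho>..1} \<Longrightarrow> L y \<le> L z" by blast
    have "L x > 0" "L z < 0" using x z \<rho> L_sign(1)[of x] L_sign(2)[of z] by auto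
    then show ?thesis
      using x(2) z(2) by (intro that[of "min (L x) (- L z)"]) (force simp: min_def)+
  qed
  \<comment> \<open>A common bound for \<open>1 / a\<close> near \<open>a0\<close>, hence for the
    radius \<open>l\<close> of the shell, and for \<open>l * a\<close> with
    \<open>a \<le> 1\<close>.\<close>
  define W where "W = 2 / a0"
  have W: "W > 0" using a0 by (simp add: W_def)
  have "continuous_on ({1 - 1/2..1 + 1/2} \<times> {0..W}) (\<lambda>(y, w). y ^ m * k (y * w))"
    unfolding split_beta
    by (intro continuous_intros continuous_on_compose2[OF k]) auto
  then obtain t1 where t1: "t1 > 0" "t1 \<le> 1/2" "\<And>t w. 0 < t \<Longrightarrow> t < t1 \<Longrightarrow> w \<in> {0..W} \<Longrightarrow>
      \<bar>(1 + t) ^ m * k ((1 + t) * w) - (1 - t) ^ m * k ((1 - t) * w)\<bar> < \<gamma> / W ^ m"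
    using uniform_symmetric_difference[of "1/2" "{0..W}" "\<lambda>(y, w). y ^ m * k (y * w)" "\<gamma> / W ^ m"]
      W \<gamma> by (auto simp: divide_pos_pos)
  have "1/2 \<le> y * w \<and> y * w \<le> 3/2" if "y \<in> {1 - 1/8..1 + 1/8}" "w \<in> {3/4..5/4}" for y w :: real
  proof -
    have "7/8 * (3/4) \<le> y * w" "y * w \<le> 9/8 * (5/4)"
      by (rule mult_mono; use that in simp)+
    then show ?thesis by simp
  qed
  then have "continuous_on ({1 - 1/8..1 + 1/8} \<times> {3/4..5/4}) (\<lambda>(y, w). y ^ m * (y * k' (y * w)))"
    unfolding split_beta
    by (intro continuous_intros continuous_on_compose2[OF k'(2)]) auto
  then obtain t2 where t2: "t2 > 0" "t2 \<le> 1/8" "\<And>t w. 0 < t \<Longrightarrow> t < t2 \<Longrightarrow> w \<in> {3/4..5/4} \<Longrightarrow>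
      \<bar>(1 + t) ^ m * ((1 + t) * k' ((1 + t) * w)) - (1 - t) ^ m * ((1 - t) * k' ((1 - t) * w))\<bar> < c / (W ^ m * W)"
    using uniform_symmetric_difference[of "1/8" "{3/4..5/4}" "\<lambda>(y, w). y ^ m * (y * k' (y * w))" "c / (W ^ m * W)"]
      W c by (auto simp: divide_pos_pos)
  \<comment> \<open>Besides the two smallness conditions, \<open>t < 1 - (a0 + \<rho>)\<close>
    yields \<open>a1 < 1 - t\<close>, which becomes \<open>\<Lambda> > 1 + \<tau>\<close> after
    multiplication by \<open>l\<close>.\<close>
  define t where "t = min (min t1 t2) (1 - (a0 + \<rho>)) / 2"
  have t: "0 < t" "t < t1" "t < t2" "t < 1 - (a0 + \<rho>)"
    using t1 t2 \<rho> by (auto simp: t_def min_def)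
  \<comment> \<open>The total at \<open>a\<close> when the shell itself is centred at radius
    \<open>1 / a\<close>. A zero \<open>a1\<close> of \<open>g\<close> is therefore a zero of the
    total for the shell fixed at \<open>1 / a1\<close>.\<close>
  define g where "g a = L a + (1 / a) ^ m * ((1 + t) ^ m * k (1 + t) - (1 - t) ^ m * k (1 - t))" for a
  have inv: "1 / a > 0 \<and> 1 / a \<le> W" if "\<bar>a - a0\<bar> \<le> \<rho>" for a
  proof -
    have "a \<ge> a0 / 2" using that \<rho> a0 by linarith
    then show ?thesis using a0 by (auto simp: W_def divide_simps)
  qed
  have small: "\<bar>l ^ m * ((1 + t) ^ m * k ((1 + t) * w) - (1 - t) ^ m * k ((1 - t) * w))\<bar> < \<gamma>"
    if "0 < l" "l \<le> W" "w \<in> {0..W}" for l w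
  proof -
    have "l ^ m \<le> W ^ m" using that by (intro power_mono) auto
    then have "l ^ m * \<bar>(1 + t) ^ m * k ((1 + t) * w) - (1 - t) ^ m * k ((1 - t) * w)\<bar>
       \<le> W ^ m * \<bar>(1 + t) ^ m * k ((1 + t) * w) - (1 - t) ^ m * k ((1 - t) * w)\<bar>"
      by (intro mult_right_mono) auto
    also have "\<dots> < W ^ m * (\<gamma> / W ^ m)"
      using t1(3)[of t w] t that W by (intro mult_strict_left_mono) auto
    finally show ?thesis using that W by (simp add: abs_mult)
  qed
  have W1: "1 \<in> {0..W}" using a0 by (auto simp: W_def divide_simps)
  have g_cont: "continuous_on {a0 - \<rho>..a0 + \<rho>} g"
    unfolding g_def[abs_def] using \<rho> a0
    by (intro continuous_intros continuous_on_subset[OF L]) auto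
  have g_lo: "g (a0 - \<rho>) \<ge> 0"
    using small[of "1 / (a0 - \<rho>)" 1] inv[of "a0 - \<rho>"] \<rho> W1 \<gamma>(2)[of "a0 - \<rho>"] a0
    by (simp add: g_def)
  have g_hi: "g (a0 + \<rho>) \<le> 0"
    using small[of "1 / (a0 + \<rho>)" 1] inv[of "a0 + \<rho>"] \<rho> W1 \<gamma>(3)[of "a0 + \<rho>"] a0
    by (simp add: g_def)
  obtain a1 where a1: "a0 - \<rho> \<le> a1" "a1 \<le> a0 + \<rho>" "g a1 = 0"
    using IVT2'[of g "a0 + \<rho>" 0 "a0 - \<rho>"] g_lo g_hi g_cont \<rho> by auto
  have a1pos: "a1 \<ge> 15/16 * a0" "a1 > 0" using a1 \<rho> a0 by linarith+
  define l where "l = 1 / a1"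
  have l: "l > 0" "l \<le> W" "l * a1 = 1"
    using inv[of a1] a1 a1pos by (auto simp: l_def)
  \<comment> \<open>From here on the shell is fixed and only \<open>a\<close> varies.\<close>
  define E where "E a = L a + (l + t * l) ^ m * k ((l + t * l) * a) - (l - t * l) ^ m * k ((l - t * l) * a)" for a
  have E_eq: "E a = L a + l ^ m * ((1 + t) ^ m * k ((1 + t) * (l * a)) - (1 - t) ^ m * k ((1 - t) * (l * a)))" for a
  proof -
    have e: "l + t * l = l * (1 + t)" "l - t * l = l * (1 - t)"
      "l * (1 + t) * a = (1 + t) * (l * a)" "l * (1 - t) * a = (1 - t) * (l * a)"
      by (auto simp: algebra_simps)
    show ?thesis unfolding E_def e power_mult_distrib by (simp add: algebra_simps)
  qed
  have E1: "E a1 = 0"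
    using a1(3) l(3) unfolding E_eq g_def by (simp add: l_def)
  have E_deriv: "\<exists>y. (E has_real_derivative y) (at a) \<and> y < 0" if "a0 - \<rho> \<le> a" "a \<le> a0 + \<rho>" for a
  proof -
    have w: "l * a \<in> {3/4..5/4}"
    proof -
      have "\<bar>a - a1\<bar> \<le> a0 / 8" using that a1 \<rho> by linarith
      then have "\<bar>a - a1\<bar> \<le> a1 / 4" using a1pos a0 by linarith
      then have "l * \<bar>a - a1\<bar> \<le> l * (a1 / 4)" using l by (intro mult_left_mono) auto
      moreover have "l * a - 1 = l * (a - a1)" using l(3) by (simp add: right_diff_distrib)
      ultimately have "\<bar>l * a - 1\<bar> \<le> l * a1 / 4" using l(1) by (simp add: abs_mult)
      then have "\<bar>l * a - 1\<bar> \<le> 1 / 4" using l(3) by simp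
      then have "l * a - 1 \<le> 1 / 4" "- (l * a - 1) \<le> 1 / 4" by (simp_all only: abs_le_iff)
      then show ?thesis by simp
    qed
    have yw: "(1 + t) * (l * a) \<in> {1/2..3/2}" "(1 - t) * (l * a) \<in> {1/2..3/2}"
    proof -
      have t8: "t \<le> 1/8" using t t2 by simp
      have "1 * (3/4) \<le> (1 + t) * (l * a)" "(1 + t) * (l * a) \<le> 9/8 * (5/4)"
        using t8 t w by (intro mult_mono; simp)+
      moreover have "7/8 * (3/4) \<le> (1 - t) * (l * a)" "(1 - t) * (l * a) \<le> 1 * (5/4)"
        using t8 t w by (intro mult_mono; simp)+
      ultimately show "(1 + t) * (l * a) \<in> {1/2..3/2}" "(1 - t) * (l * a) \<in> {1/2..3/2}" by auto
    qed
    have k1: "((\<lambda>a. k (s * (l * a))) has_real_derivative k' (s * (l * a)) * (s * l)) (at a)"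
      if "s * (l * a) \<in> {1/2..3/2}" for s
      using that by (intro DERIV_chain2[where g="\<lambda>a. s * (l * a)", OF k'(1)])
        (auto intro!: derivative_eq_intros)
    let ?d = "(1 + t) ^ m * ((1 + t) * k' ((1 + t) * (l * a))) - (1 - t) ^ m * ((1 - t) * k' ((1 - t) * (l * a)))"
    have "(E has_real_derivative (L' a + l ^ m * ((1 + t) ^ m * (k' ((1 + t) * (l * a)) * ((1 + t) * l))
       - (1 - t) ^ m * (k' ((1 - t) * (l * a)) * ((1 - t) * l))))) (at a)"
      unfolding E_eq[abs_def] using that \<rho> a0
      by (intro DERIV_add DERIV_cmult DERIV_diff k1 L' yw) auto
    moreover have "L' a + l ^ m * ((1 + t) ^ m * (k' ((1 + t) * (l * a)) * ((1 + t) * l))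
       - (1 - t) ^ m * (k' ((1 - t) * (l * a)) * ((1 - t) * l))) = L' a + l ^ m * l * ?d"
      by (simp add: algebra_simps)
    \<comment> \<open>The shell alters the slope by less than \<open>c\<close>, so the total still
      decreases strictly and \<open>a1\<close> is its only zero near \<open>a0\<close>.\<close>
    moreover have "l ^ m * l * ?d < c"
    proof -
      have "l ^ m * l * ?d \<le> (l ^ m * l) * \<bar>?d\<bar>" using l by (intro mult_left_mono) auto
      also have "\<dots> \<le> (W ^ m * W) * \<bar>?d\<bar>"
        using l W by (intro mult_right_mono mult_mono power_mono) auto
      also have "\<dots> < (W ^ m * W) * (c / (W ^ m * W))"
        using t2(3)[of t "l * a"] t w W by (intro mult_strict_left_mono) auto
      finally show ?thesis using W by simp
    qed
    moreover have "L' a < - c" using that \<rho>(4)[of a] by (simp add: abs_le_iff)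
    ultimately show ?thesis by (intro exI[of _ "L' a + l ^ m * l * ?d"]) auto
  qed
  have dec: "E y < E x" if "a0 - \<rho> \<le> x" "x < y" "y \<le> a0 + \<rho>" for x y
    using that by (intro DERIV_neg_imp_decreasing[of x y E] E_deriv) auto
  show ?thesis
  proof (rule that[of "t * l" l])
    show "t * l > 0" using t l by simp
    have "l * a1 < l * (1 - t)" using a1 t l by (intro mult_strict_left_mono) auto
    then show "l > 1 + t * l" using l by (simp add: algebra_simps)
    fix a assume a: "0 < a" "a \<le> 1" "l * a \<noteq> 1"
    have "E a \<noteq> 0"
    proof (cases "\<bar>a - a0\<bar> \<le> \<rho>")
      case True
      moreover have "a \<noteq> a1" using a l by auto
      moreover have "a0 - \<rho> \<le> a" "a \<le> a0 + \<rho>" using True by linarith+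
      ultimately show ?thesis using dec[of a a1] dec[of a1 a] E1 a1 by (cases a a1 rule: linorder_cases) auto
    next
      \<comment> \<open>Away from \<open>a0\<close> the shell contributes less than \<gamma> and
        cannot cancel \<open>L\<close>.\<close>
      case False
      have "l * a \<in> {0..W}" using a l mult_mono[of l W a 1] by auto
      then have "\<bar>E a - L a\<bar> < \<gamma>" using small[of l "l * a"] l by (simp add: E_eq)
      moreover have "\<bar>L a\<bar> \<ge> \<gamma>" using False \<gamma>(2)[of a] \<gamma>(3)[of a] a by (cases "a \<le> a0") auto
      ultimately show ?thesis by auto
    qed
    then show "L a + (l + t * l) ^ m * k ((l + t * l) * a) - (l - t * l) ^ m * k ((l - t * l) * a) \<noteq> 0"
      by (simp add: E_def)
  qed
qed

text \<open>\<open>shell_placement\<close> for \<open>slope\<close> and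
  \<open>annulus_slope\<close>, with \<open>a = 1 / R\<close>; the excluded value
  \<open>\<Lambda> * a = 1\<close> means \<open>R = \<Lambda>\<close>.\<close>

lemma critical_shell:
  assumes n: "n \<ge> 4" and \<delta>: "0 < \<delta>" "\<delta> \<le> 1 / (4 * real n)"
  obtains \<tau> \<Lambda> where "\<tau> > 0" "\<Lambda> > 1 + \<tau>"
    "\<And>a. 0 < a \<Longrightarrow> a \<le> 1 \<Longrightarrow> \<Lambda> * a \<noteq> 1 \<Longrightarrow>
       annulus_slope n \<delta> a + (\<Lambda> + \<tau>) ^ (n - 1) * slope n ((\<Lambda> + \<tau>) * a)
        - (\<Lambda> - \<tau>) ^ (n - 1) * slope n ((\<Lambda> - \<tau>) * a) \<noteq> 0"
proof -
  obtain x0 where x0: "0 < x0" "x0 < 1 / 2" "annulus_nslope n \<delta> x0 = 0" "annulus_rate n \<delta> x0 > 0"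
    and sign: "\<And>x. 0 < x \<Longrightarrow> x < x0 \<Longrightarrow> annulus_nslope n \<delta> x > 0"
    "\<And>x. x0 < x \<Longrightarrow> x \<le> 1 / 2 \<Longrightarrow> annulus_nslope n \<delta> x < 0"
    using annulus_nslope_sign[OF n \<delta>] by blast
  have "1 / (4 * real n) \<le> 1 / 16" using n by (simp add: divide_simps)
  then have \<delta>1: "\<delta> < 1" using \<delta> by simp
  have eq: "annulus_slope n \<delta> a = real n * a * annulus_nslope n \<delta> (a / 2)" if "a > 0" for a
    using annulus_slope_eq[of n "a / 2" \<delta>] that n \<delta> by simp
  let ?L' = "\<lambda>a. slope' n a - \<delta> ^ (n - 1) * (slope' n (\<delta> * a) * \<delta>)"
  have deriv: "(annulus_slope n \<delta> has_real_derivative ?L' a) (at a)" if "0 < a" "a < 1" for a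
  proof -
    have "\<delta> * a < 1" using that \<delta> \<delta>1 mult_strict_mono[of \<delta> 1 a 1] by simp
    then have "((\<lambda>a. slope n (\<delta> * a)) has_real_derivative slope' n (\<delta> * a) * \<delta>) (at a)"
      using that \<delta> by (intro DERIV_chain2[where g="\<lambda>a. \<delta> * a", OF slope_has_derivative])
        (auto intro!: derivative_eq_intros)
    then show ?thesis unfolding annulus_slope_def[abs_def] using that
      by (intro DERIV_diff DERIV_cmult slope_has_derivative) auto
  qed
  \<comment> \<open>Since \<open>annulus_nslope\<close> vanishes at \<open>x0\<close>, the product
    rule leaves a positive multiple of its derivative there, whose sign is known from
    \<open>annulus_rate\<close>. Uniqueness of the derivative transfers it to
    \<open>?L'\<close>.\<close>
  have deriv_neg: "?L' (2 * x0) < 0"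
  proof -
    let ?r = "- annulus_rate n \<delta> x0 / (2 * real n * x0\<^sup>2)"
    have "(annulus_nslope n \<delta> has_real_derivative ?r) (at (2 * x0 / 2))"
      using annulus_nslope_has_derivative[of n x0 \<delta>] x0 n \<delta> \<delta>1 by simp
    then have "((\<lambda>a. annulus_nslope n \<delta> (a / 2)) has_real_derivative ?r * (1 / 2)) (at (2 * x0))"
      by (rule DERIV_chain2[where g="\<lambda>a. a / 2"]) (auto intro!: derivative_eq_intros)
    then have "((\<lambda>a. real n * a * annulus_nslope n \<delta> (a / 2)) has_real_derivative
        (real n * annulus_nslope n \<delta> (2 * x0 / 2) + ?r * (1 / 2) * (real n * (2 * x0)))) (at (2 * x0))"
      by (auto intro!: derivative_eq_intros)
    moreover have "eventually (\<lambda>a. real n * a * annulus_nslope n \<delta> (a / 2) = annulus_slope n \<delta> a) (nhds (2 * x0))"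
      using eventually_nhds_in_open[of "{0<..}" "2 * x0"] x0 by (auto elim!: eventually_mono simp: eq)
    ultimately have "(annulus_slope n \<delta> has_real_derivative ?r * (1 / 2) * (real n * (2 * x0))) (at (2 * x0))"
      using x0(3) DERIV_cong_ev[of "2 * x0" "2 * x0" "\<lambda>a. real n * a * annulus_nslope n \<delta> (a / 2)"
        "annulus_slope n \<delta>"] by simp
    from DERIV_unique[OF deriv this] have "?L' (2 * x0) = ?r * (1 / 2) * (real n * (2 * x0))"
      using x0 by simp
    also have "\<dots> < 0" using x0 n by (intro mult_neg_pos) (auto intro!: divide_neg_pos)
    finally show ?thesis .
  qed
  show ?thesis
  proof (rule shell_placement[of "slope n" "slope' n" "annulus_slope n \<delta>" "2 * x0" ?L' "n - 1"])
    show "continuous_on {0..} (slope n)" by (intro continuous_intros)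
    show "continuous_on {1/2..3/2} (slope' n)" by (intro continuous_on_slope') auto
    show "continuous_on {0..1} (annulus_slope n \<delta>)"
      unfolding annulus_slope_def[abs_def] by (intro continuous_intros)
    show "continuous_on {0<..<1} ?L'"
    proof (intro continuous_intros continuous_on_slope' continuous_on_compose2[where g="slope' n" and f="\<lambda>a. \<delta> * a"])
      show "(\<lambda>a. \<delta> * a) ` {0<..<1} \<subseteq> {0<..<1}"
        using \<delta> \<delta>1 mult_strict_mono[of \<delta> 1 _ 1] by auto
    qed auto
    show "annulus_slope n \<delta> a > 0" if "0 \<le> a" "a < 2 * x0" for a
    proof (cases "a = 0")
      case True
      then show ?thesis using \<delta> \<delta>1 n by (simp add: annulus_slope_def slope_0 power_less_one_iff)
    next
      case False
      then show ?thesis using that sign(1)[of "a / 2"] n by (simp add: eq)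
    qed
    show "annulus_slope n \<delta> a < 0" if "2 * x0 < a" "a \<le> 1" for a
      using that sign(2)[of "a / 2"] n x0 by (simp add: eq mult_pos_neg)
    show "?L' (2 * x0) < 0" by (rule deriv_neg)
    show "(annulus_slope n \<delta> has_real_derivative ?L' a) (at a)" if "0 < a" "a < 1" for a
      using that by (rule deriv)
  qed (use x0 in \<open>auto intro!: slope_has_derivative that\<close>)
qed

section \<open>Volumes of caps and lenses\<close>

text \<open>
  The library version \<open>measure_orthogonal_image\<close> needs a well-ordered index type. Here open sets are
  exhausted by disjoint balls up to a null set, and balls are mapped to balls.
\<close>

lemma emeasure_orthogonal_image_open:
  fixes f :: "'a::euclidean_space \<Rightarrow> 'a"
  assumes f: "orthogonal_transformation f" and S: "open S"
  shows "emeasure lebesgue (f ` S) = emeasure lebesgue S"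
proof -
  define K where "K = {p :: 'a \<times> real. snd p > 0 \<and> ball (fst p) (snd p) \<subseteq> S}"
  obtain C where C: "countable C" "C \<subseteq> K"
    "pairwise (\<lambda>i j. disjnt (ball (fst i) (snd i)) (ball (fst j) (snd j))) C"
    "negligible (S - (\<Union>i\<in>C. ball (fst i) (snd i)))"
  proof (rule Vitali_covering_theorem_balls[of S K fst snd])
    fix x and d :: real
    assume "x \<in> S" "0 < d"
    then obtain e where "e > 0" "ball x e \<subseteq> S" using S open_contains_ball by blast
    then have "ball x (min e (d / 2)) \<subseteq> S" by (auto simp: ball_def)
    then show "\<exists>i. i \<in> K \<and> x \<in> ball (fst i) (snd i) \<and> snd i < d"
      using \<open>e > 0\<close> \<open>0 < d\<close> by (intro exI[of _ "(x, min e (d / 2))"]) (auto simp: K_def)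
  qed auto
  define B where "B i = ball (fst i) (snd i)" for i :: "'a \<times> real"
  define B' where "B' i = ball (f (fst i)) (snd i)" for i :: "'a \<times> real"
  have B': "f ` B i = B' i" for i
    using image_orthogonal_transformation_ball[OF f] by (simp add: B_def B'_def)
  have disj: "disjoint_family_on B C"
    using C(3) by (auto simp: pairwise_def disjoint_family_on_def disjnt_def B_def)
  have "inj f" using f by (rule orthogonal_transformation_inj)
  then have disj': "disjoint_family_on B' C"
    using disj unfolding disjoint_family_on_def B'[symmetric]
    by (metis image_Int image_empty)
  let ?N = "S - (\<Union>i\<in>C. B i)"
  have N: "negligible ?N" using C(4) by (simp add: B_def)
  \<comment> \<open>An isometry is Lipschitz and so preserves null sets.\<close>
  have N': "negligible (f ` ?N)"
  proof (rule negligible_locally_Lipschitz_image[OF _ N])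
    fix x
    show "\<exists>T B. open T \<and> x \<in> T \<and> (\<forall>y \<in> ?N \<inter> T. norm (f y - f x) \<le> B * norm (y - x))"
      using orthogonal_transformation_norm[OF f] orthogonal_transformation_linear[OF f]
      by (intro exI[of _ UNIV] exI[of _ 1]) (auto simp: linear_diff[symmetric])
  qed auto
  have eq: "S = (\<Union>i\<in>C. B i) \<union> ?N" using C(2) by (auto simp: K_def B_def)
  have eq': "f ` S = (\<Union>i\<in>C. B' i) \<union> f ` ?N"
    by (subst eq) (simp only: image_Un image_UN B')
  have "emeasure lebesgue (f ` S) = emeasure lebesgue (\<Union>i\<in>C. B' i)"
    unfolding eq' using N' C(1)
    by (intro emeasure_Un_null_set sets.countable_UN') (auto simp: B'_def negligible_iff_null_sets)
  also have "\<dots> = (\<integral>\<^sup>+i. emeasure lebesgue (B' i) \<partial>count_space C)"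
    using C(1) disj' by (intro emeasure_UN_countable) (auto simp: B'_def[abs_def])
  also have "\<dots> = (\<integral>\<^sup>+i. emeasure lebesgue (B i) \<partial>count_space C)"
    using C(2) by (intro nn_integral_cong) (auto simp: B_def B'_def K_def emeasure_ball)
  also have "\<dots> = emeasure lebesgue (\<Union>i\<in>C. B i)"
    using C(1) disj by (intro emeasure_UN_countable[symmetric]) (auto simp: B_def[abs_def])
  also have "\<dots> = emeasure lebesgue S"
  proof -
    have "emeasure lebesgue ((\<Union>i\<in>C. B i) \<union> ?N) = emeasure lebesgue (\<Union>i\<in>C. B i)"
      using N C(1) by (intro emeasure_Un_null_set sets.countable_UN') (auto simp: B_def negligible_iff_null_sets)
    then show ?thesis using eq by metis
  qed
  finally show ?thesis .
qed

section \<open>Cap volumes by slicing\<close>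

lemma borel_measurable_profile [measurable]: "profile n \<in> borel_measurable borel"
  by (intro borel_measurable_continuous_onI continuous_intros)

lemma nn_integral_profile:
  assumes "n \<ge> 2"
  shows "(\<integral>\<^sup>+u. indicator {x<..} u * ennreal (profile n u) \<partial>lborel) = ennreal (cap n x)"
proof (cases "x < 1")
  case True
  have "(\<integral>\<^sup>+u. indicator {x<..} u * ennreal (profile n u) \<partial>lborel)
      = (\<integral>\<^sup>+u. ennreal (profile n u) * indicator {x..1} u \<partial>lborel)"
  proof (rule nn_integral_cong_AE)
    have "AE u in lborel. u \<noteq> x" by (rule AE_lborel_singleton)
    then show "AE u in lborel. indicator {x<..} u * ennreal (profile n u) = ennreal (profile n u) * indicator {x..1} u"
      by eventually_elim (use assms in \<open>auto simp: indicator_def profile_eq_0\<close>)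
  qed
  also have "\<dots> = ennreal (- cap n 1 - - cap n x)"
  proof (rule nn_integral_FTC_Icc[where F="\<lambda>x. - cap n x"])
    show "DERIV (\<lambda>x. - cap n x) u :> profile n u" for u
      using DERIV_minus[OF cap_has_derivative[of n u]] by simp
  qed (use True in \<open>auto simp: profile_nonneg\<close>)
  finally show ?thesis by simp
next
  case False
  then have "(\<integral>\<^sup>+u. indicator {x<..} u * ennreal (profile n u) \<partial>lborel) = (\<integral>\<^sup>+u. 0 \<partial>(lborel :: real measure))"
    using assms by (intro nn_integral_cong) (auto simp: indicator_def profile_eq_0)
  then show ?thesis using False assms by (simp add: cap_eq_0)
qed

text \<open>Fubini along the coordinate \<open>b\<close>: the slice at height \<open>y\<close> is an
  (n-1)-dimensional ball of radius \<open>sqrt (1 - y\<^sup>2)\<close>, whose volume is proportional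
  to \<open>profile\<close>.\<close>

lemma emeasure_basis_cap:
  assumes b: "(b :: 'a::euclidean_space) \<in> Basis" and n: "DIM('a) \<ge> 2"
  shows "emeasure lborel {y :: 'a. norm y \<le> 1 \<and> x < y \<bullet> b}
    = ennreal (unit_ball_vol (real (DIM('a) - 1)) * cap DIM('a) x)"
proof -
  interpret product_sigma_finite "\<lambda>_. lborel" by standard
  define A where "A = (Basis :: 'a set) - {b}"
  have A: "finite A" "b \<notin> A" "Basis = insert b A" "card A = DIM('a) - 1"
    using b by (auto simp: A_def)
  let ?P = "\<lambda>I. Pi\<^sub>M I (\<lambda>_. lborel :: real measure)"
  let ?S = "\<lambda>r. {f. sqrt (\<Sum>i\<in>A. (f i)\<^sup>2) \<le> r} \<inter> space (?P A)"
  let ?c = "unit_ball_vol (real (DIM('a) - 1))"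
  have inn: "(\<Sum>b\<in>Basis. f b *\<^sub>R b :: 'a) \<bullet> b = f b" for f
    using b by simp
  have nrm: "norm (\<Sum>b\<in>Basis. f b *\<^sub>R b :: 'a) = sqrt ((f b)\<^sup>2 + (\<Sum>i\<in>A. (f i)\<^sup>2))" for f
  proof -
    have "norm (\<Sum>b\<in>Basis. f b *\<^sub>R b :: 'a) = sqrt (\<Sum>i\<in>Basis. (f i)\<^sup>2)"
      using euclidean_dist_l2[of "\<Sum>b\<in>Basis. f b *\<^sub>R b :: 'a" 0] by (simp add: L2_set_def)
    moreover have "(\<Sum>i\<in>Basis. (f i)\<^sup>2) = (f b)\<^sup>2 + (\<Sum>i\<in>A. (f i)\<^sup>2)"
      unfolding A(3) using A(1,2) by simp
    ultimately show ?thesis by simp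
  qed
  have "(lborel :: 'a measure) = distr (?P Basis) borel (\<lambda>f. \<Sum>b\<in>Basis. f b *\<^sub>R b)"
    by (rule lborel_eq)
  also have "emeasure \<dots> {y :: 'a. norm y \<le> 1 \<and> x < y \<bullet> b} =
      emeasure (?P Basis) ((\<lambda>f. \<Sum>b\<in>Basis. f b *\<^sub>R b :: 'a) -` {y. norm y \<le> 1 \<and> x < y \<bullet> b} \<inter> space (?P Basis))"
    by (subst emeasure_distr) simp_all
  also have "(\<lambda>f. \<Sum>b\<in>Basis. f b *\<^sub>R b :: 'a) -` {y. norm y \<le> 1 \<and> x < y \<bullet> b}
      = {f. sqrt ((f b)\<^sup>2 + (\<Sum>i\<in>A. (f i)\<^sup>2)) \<le> 1 \<and> x < f b}"
    unfolding vimage_def mem_Collect_eq nrm inn ..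
  also have "emeasure (?P Basis) (\<dots> \<inter> space (?P Basis)) =
     (\<integral>\<^sup>+ f. indicator ({f. sqrt ((f b)\<^sup>2 + (\<Sum>i\<in>A. (f i)\<^sup>2)) \<le> 1 \<and> x < f b} \<inter> space (?P Basis)) f \<partial>?P Basis)"
    using b by (subst nn_integral_indicator) (auto simp: A_def)
  also have "\<dots> = (\<integral>\<^sup>+ y. \<integral>\<^sup>+ f. indicator ({f. sqrt ((f b)\<^sup>2 + (\<Sum>i\<in>A. (f i)\<^sup>2)) \<le> 1 \<and> x < f b}
      \<inter> space (?P Basis)) (f(b := y)) \<partial>?P A \<partial>lborel)"
    unfolding A(3) using A(1,2) by (subst product_nn_integral_insert_rev) auto
  also have "\<dots> = (\<integral>\<^sup>+ y. \<integral>\<^sup>+ f. indicator ({x<..} \<inter> {-1..1}) y * indicator (?S (sqrt (1 - y\<^sup>2))) f \<partial>?P A \<partial>lborel)"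
  proof (intro nn_integral_cong, goal_cases)
    case (1 y f)
    have sq: "y \<in> {-1..1}" if "y\<^sup>2 + c \<le> 1" "c \<ge> 0" for c
      using that abs_square_le_1[of y] by (auto simp: abs_le_iff)
    have "(\<Sum>i\<in>A. ((f(b := y)) i)\<^sup>2) = (\<Sum>i\<in>A. (f i)\<^sup>2)"
      using A by (intro sum.cong) auto
    moreover have "f(b := y) \<in> space (?P Basis)"
      using 1 A by (auto simp: space_PiM PiE_def extensional_def)
    moreover have "y\<^sup>2 \<le> 1" if "y \<in> {-1..1}" using that abs_square_le_1[of y] by auto
    ultimately show ?case using 1 sq[of "\<Sum>i\<in>A. (f i)\<^sup>2"]
      by (auto simp: indicator_def sum_nonneg algebra_simps)
  qed
  also have "\<dots> = (\<integral>\<^sup>+ y. indicator ({x<..} \<inter> {-1..1}) y * emeasure (?P A) (?S (sqrt (1 - y\<^sup>2))) \<partial>lborel)"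
    using A(1) by (intro nn_integral_cong, subst nn_integral_cmult)
      (auto intro!: arg_cong2[where f="(*)"] nn_integral_indicator)
  also have "\<dots> = (\<integral>\<^sup>+ y. ennreal ?c * (indicator {x<..} y * ennreal (profile DIM('a) y)) \<partial>lborel)"
  proof (rule nn_integral_cong_AE)
    \<comment> \<open>Without the two end points, every slice either has positive radius or is cut
      off by the indicator.\<close>
    have "AE y in lborel. y \<notin> {-1, 1::real}"
      by (intro AE_not_in countable_imp_null_set_lborel) auto
    then show "AE y in lborel. indicator ({x<..} \<inter> {-1..1}) y * emeasure (?P A) (?S (sqrt (1 - y\<^sup>2)))
        = ennreal ?c * (indicator {x<..} y * ennreal (profile DIM('a) y))"
    proof eventually_elim
      case (elim y)
      show ?case
      proof (cases "\<bar>y\<bar> < 1")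
        case True
        then have "1 - y\<^sup>2 > 0" by (simp add: abs_square_less_1)
        then have "emeasure (?P A) (?S (sqrt (1 - y\<^sup>2))) = ennreal (?c * profile DIM('a) y)"
          using emeasure_cball_aux[OF A(1), of "sqrt (1 - y\<^sup>2)"] A(4) by (simp add: profile_def)
        also have "\<dots> = ennreal ?c * ennreal (profile DIM('a) y)"
          by (rule ennreal_mult) (simp_all add: profile_nonneg)
        finally show ?thesis using True by (auto simp: indicator_def)
      next
        case False
        then have "\<bar>y\<bar> > 1" using elim by auto
        then show ?thesis using n by (auto simp: indicator_def profile_eq_0)
      qed
    qed
  qed
  also have "\<dots> = ennreal ?c * ennreal (cap DIM('a) x)"
    by (subst nn_integral_cmult) (use n in \<open>auto simp: nn_integral_profile\<close>)
  also have "\<dots> = ennreal (?c * cap DIM('a) x)"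
    by (simp add: ennreal_mult')
  finally show ?thesis .
qed

lemma cap_nonneg:
  assumes "n \<ge> 2" shows "cap n x \<ge> 0"
proof (cases "x < 1")
  case True
  then obtain z where "cap n 1 - cap n x = (1 - x) * (- profile n z)"
    using MVT2[of x 1 "cap n" "\<lambda>x. - profile n x"] cap_has_derivative by force
  then show ?thesis using True profile_nonneg[of n z] mult_nonneg_nonneg[of "1 - x" "profile n z"] by simp
qed (use assms cap_eq_0 in simp)

text \<open>An orthogonal map taking a basis vector to \<open>e\<close> reduces this to slices along
  a coordinate; the open and the closed ball differ by the null sphere.\<close>

lemma measure_unit_cap:
  fixes e :: "real ^ 'n"
  assumes e: "norm e = 1" and n: "CARD('n) \<ge> 2"
  shows "measure lebesgue {y. norm y < 1 \<and> x < y \<bullet> e} = unit_ball_vol (real (CARD('n) - 1)) * cap CARD('n) x"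
proof -
  obtain b :: "real ^ 'n" where b: "b \<in> Basis" using nonempty_Basis by blast
  obtain f where f: "orthogonal_transformation f" "f b = e"
    using orthogonal_transformation_exists[of b e] b e by auto
  let ?S = "\<lambda>e :: real ^ 'n. {y. norm y < 1 \<and> x < y \<bullet> e}"
  have opn: "open (?S e)" for e
    by (intro open_Collect_conj open_Collect_less continuous_intros)
  have "?S e = f ` ?S b"
  proof (intro set_eqI iffI)
    fix y assume y: "y \<in> ?S e"
    obtain z where z: "y = f z" using orthogonal_transformation_surj[OF f(1)] by blast
    then have "z \<in> ?S b"
      using y f orthogonal_transformation_norm[OF f(1)] by (auto simp: orthogonal_transformation_def)
    then show "y \<in> f ` ?S b" using z by blast
  qed (use f orthogonal_transformation_norm[OF f(1)] in \<open>auto simp: orthogonal_transformation_def\<close>)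
  then have "emeasure lebesgue (?S e) = emeasure lebesgue (?S b)"
    using emeasure_orthogonal_image_open[OF f(1) opn] by simp
  also have "\<dots> = emeasure lborel (?S b)"
    using opn by (simp add: emeasure_completion)
  also have "\<dots> = emeasure lborel {y. norm y \<le> 1 \<and> x < y \<bullet> b}"
  proof (rule emeasure_eq_AE)
    have "sphere 0 1 \<in> null_sets (lborel :: (real ^ 'n) measure)"
      using negligible_sphere[of "0 :: real ^ 'n" 1]
      by (auto simp: null_sets_completion_iff negligible_iff_null_sets negligible_convex_frontier)
    from AE_not_in[OF this]
    show "AE y in lborel. (y \<in> ?S b) = (y \<in> {y. norm y \<le> 1 \<and> x < y \<bullet> b})"
      by eventually_elim auto
  qed (use opn in auto)
  also have "\<dots> = ennreal (unit_ball_vol (real (CARD('n) - 1)) * cap CARD('n) x)"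
    using emeasure_basis_cap[OF b, of x] n by simp
  finally show ?thesis
    using cap_nonneg[OF n, of x] by (simp add: measure_def)
qed

lemma measure_origin_cap:
  fixes e :: "real ^ 'n"
  assumes e: "norm e = 1" and n: "CARD('n) \<ge> 2" and s: "s > 0"
  shows "measure lebesgue {y \<in> ball 0 s. t < y \<bullet> e}
    = unit_ball_vol (real (CARD('n) - 1)) * (s ^ CARD('n) * cap CARD('n) (t / s))"
proof -
  have "{y \<in> ball 0 s. t < y \<bullet> e} = (\<lambda>y. s *\<^sub>R y + 0) ` {y. norm y < 1 \<and> t / s < y \<bullet> e}"
  proof (intro set_eqI iffI)
    fix y assume "y \<in> {y \<in> ball 0 s. t < y \<bullet> e}"
    then have "y = s *\<^sub>R (y /\<^sub>R s) + 0" "y /\<^sub>R s \<in> {y. norm y < 1 \<and> t / s < y \<bullet> e}"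
      using s by (auto simp: field_simps)
    then show "y \<in> (\<lambda>y. s *\<^sub>R y + 0) ` {y. norm y < 1 \<and> t / s < y \<bullet> e}" by blast
  qed (use s in \<open>auto simp: field_simps\<close>)
  then show ?thesis
    using measure_lebesgue_affine[of s "0 :: real ^ 'n" "{y. norm y < 1 \<and> t / s < y \<bullet> e}"]
      measure_unit_cap[OF e n, of "t / s"] s by simp
qed

text \<open>The negative scaling factor \<open>- r\<close> reflects the half space, so the part of
  the ball below \<open>t\<close> is again the image of an upper cap.\<close>

lemma measure_far_cap:
  fixes e X :: "real ^ 'n"
  assumes e: "norm e = 1" and n: "CARD('n) \<ge> 2" and r: "r > 0"
  shows "measure lebesgue {y \<in> ball X r. y \<bullet> e < t}
    = unit_ball_vol (real (CARD('n) - 1)) * (r ^ CARD('n) * cap CARD('n) ((X \<bullet> e - t) / r))"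
proof -
  let ?S = "{y. norm y < 1 \<and> (X \<bullet> e - t) / r < y \<bullet> e}"
  have "{y \<in> ball X r. y \<bullet> e < t} = (\<lambda>y. (- r) *\<^sub>R y + X) ` ?S"
  proof (intro set_eqI iffI)
    fix y assume "y \<in> {y \<in> ball X r. y \<bullet> e < t}"
    then have "norm ((X - y) /\<^sub>R r) < 1" "(X \<bullet> e - t) / r < (X \<bullet> e - y \<bullet> e) / r"
      using r by (simp_all add: dist_norm divide_strict_right_mono inverse_eq_divide)
    then have "y = (- r) *\<^sub>R ((X - y) /\<^sub>R r) + X" "(X - y) /\<^sub>R r \<in> ?S"
      using r by (simp_all add: inner_diff_left divide_inverse_commute)
    then show "y \<in> (\<lambda>y. (- r) *\<^sub>R y + X) ` ?S" by blast
  qed (use r in \<open>auto simp: field_simps dist_norm inner_diff_left\<close>)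
  then show ?thesis
    using measure_lebesgue_affine[of "- r" X ?S] measure_unit_cap[OF e n, of "(X \<bullet> e - t) / r"] r by simp
qed

text \<open>
  The hyperplane through the intersection of the two spheres cuts the lens into two caps. If the spheres
  do not meet, the conventions for \<open>cap\<close> outside \<open>[-1, 1]\<close> make the formula correct as well.
\<close>

lemma measure_lens:
  fixes X :: "real ^ 'n"
  assumes X: "X \<noteq> 0" and n: "CARD('n) \<ge> 2" and pos: "r > 0" "s > 0"
  shows "measure lebesgue (ball X r \<inter> ball 0 s) = unit_ball_vol (real (CARD('n) - 1)) *
    (r ^ CARD('n) * cap CARD('n) (((norm X)\<^sup>2 + r\<^sup>2 - s\<^sup>2) / (2 * norm X * r))
     + s ^ CARD('n) * cap CARD('n) (((norm X)\<^sup>2 + s\<^sup>2 - r\<^sup>2) / (2 * norm X * s)))"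
proof -
  define R where "R = norm X"
  define e where "e = X /\<^sub>R R"
  \<comment> \<open>The height along \<open>e\<close> of the radical hyperplane, on which the
    squared distances to both centres exceed the squared radii by the same amount.\<close>
  define t where "t = (R\<^sup>2 + s\<^sup>2 - r\<^sup>2) / (2 * R)"
  have R: "R > 0" using X by (simp add: R_def)
  have e: "norm e = 1" "X = R *\<^sub>R e" using R by (auto simp: e_def R_def)
  have Xe: "X \<bullet> e = R" using e by (simp add: dot_square_norm)
  let ?A = "{y \<in> ball 0 s. t < y \<bullet> e}" and ?B = "{y \<in> ball X r. y \<bullet> e < t}"
  have dist: "(dist X y)\<^sup>2 = R\<^sup>2 - 2 * R * (y \<bullet> e) + (norm y)\<^sup>2" for y
    by (simp add: dist_norm power2_norm_eq_inner inner_diff R_def inner_commute)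
       (simp add: e_def R_def inner_commute X power2_norm_eq_inner[symmetric])
  have t: "2 * R * t = R\<^sup>2 + s\<^sup>2 - r\<^sup>2" using R by (simp add: t_def)
  have inX: "y \<in> ball X r \<longleftrightarrow> R\<^sup>2 - 2 * R * (y \<bullet> e) + (norm y)\<^sup>2 < r\<^sup>2" for y
    using pos unfolding dist[symmetric] by (auto simp: power_strict_mono intro: power2_less_imp_less)
  have in0: "y \<in> ball 0 s \<longleftrightarrow> (norm y)\<^sup>2 < s\<^sup>2" for y :: "real ^ 'n"
    using pos by (auto simp: power_strict_mono intro: power2_less_imp_less)
  \<comment> \<open>The difference of the two excesses is
    \<open>2 * R * (t - y \<bullet> e)\<close>. Hence above \<open>t\<close> membership in the ball
    about 0 implies membership in the other ball, and below \<open>t\<close> conversely.\<close>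
  have A: "y \<in> ball X r" if "y \<in> ?A" for y
  proof -
    have "2 * R * t < 2 * R * (y \<bullet> e)" using that R by simp
    then show ?thesis using that t unfolding inX mem_Collect_eq in0 by linarith
  qed
  have B: "y \<in> ball 0 s" if "y \<in> ?B" for y
  proof -
    have "2 * R * (y \<bullet> e) < 2 * R * t" using that R by simp
    then show ?thesis using that t unfolding mem_Collect_eq inX in0 by linarith
  qed
  have meas: "?A \<in> lmeasurable" "?B \<in> lmeasurable"
  proof -
    have "open ?A" "open ?B"
      unfolding ball_def by (auto intro!: open_Collect_conj open_Collect_less continuous_intros)
    moreover have "bounded ?A" "bounded ?B"
      by (rule bounded_subset[OF bounded_ball]; blast)+
    ultimately show "?A \<in> lmeasurable" "?B \<in> lmeasurable" by (auto intro: lmeasurable_open)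
  qed
  \<comment> \<open>Only points of the hyperplane itself are lost.\<close>
  have "measure lebesgue (ball X r \<inter> ball 0 s) = measure lebesgue (?A \<union> ?B)"
  proof (rule measure_negligible_symdiff)
    have "negligible {y. e \<bullet> y = t}" using e by (intro negligible_hyperplane) auto
    moreover have "sym_diff (?A \<union> ?B) (ball X r \<inter> ball 0 s) \<subseteq> {y. e \<bullet> y = t}"
      using A B by (auto simp: inner_commute)
    ultimately show "negligible (sym_diff (?A \<union> ?B) (ball X r \<inter> ball 0 s))"
      by (rule negligible_subset)
  qed (rule fmeasurable.Un[OF meas])
  also have "\<dots> = measure lebesgue ?A + measure lebesgue ?B"
    using meas by (intro measure_Un_AE[OF AE_I2]) auto
  also have "\<dots> = unit_ball_vol (real (CARD('n) - 1)) * (s ^ CARD('n) * cap CARD('n) (t / s))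
     + unit_ball_vol (real (CARD('n) - 1)) * (r ^ CARD('n) * cap CARD('n) ((R - t) / r))"
    using measure_origin_cap[OF e(1) n pos(2)] measure_far_cap[OF e(1) n pos(1), of X] Xe by simp
  also have "(R - t) / r = (R\<^sup>2 + r\<^sup>2 - s\<^sup>2) / (2 * R * r)"
    using R pos by (simp add: t_def divide_simps) (simp add: algebra_simps power2_eq_square)
  also have "t / s = (R\<^sup>2 + s\<^sup>2 - r\<^sup>2) / (2 * R * s)"
    by (simp add: t_def)
  finally show ?thesis by (simp add: R_def algebra_simps)
qed

section \<open>Averages of the two shells\<close>

text \<open>The proportion of \<open>ball X r\<close> that lies in \<open>ball 0 s\<close> when
  \<open>norm X = R > 0\<close> (\<open>measure_lens_avg\<close>), written as an explicit function
  that can be differentiated in \<open>r\<close>.\<close>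

definition lens_avg :: "nat \<Rightarrow> real \<Rightarrow> real \<Rightarrow> real \<Rightarrow> real"
  where "lens_avg n s R r = unit_ball_vol (real (n - 1)) / unit_ball_vol (real n) *
    (cap n ((R\<^sup>2 + r\<^sup>2 - s\<^sup>2) / (2 * R * r)) + (s / r) ^ n * cap n ((R\<^sup>2 + s\<^sup>2 - r\<^sup>2) / (2 * R * s)))"

definition shells_avg :: "nat \<Rightarrow> real \<Rightarrow> real \<Rightarrow> real \<Rightarrow> real \<Rightarrow> real \<Rightarrow> real"
  where "shells_avg n \<delta> \<tau> \<Lambda> R r =
    lens_avg n 1 R r - lens_avg n \<delta> R r + lens_avg n (\<Lambda> + \<tau>) R r - lens_avg n (\<Lambda> - \<tau>) R r"

lemma lens_avg_has_derivative:
  assumes "n \<ge> 1" "R > 0" "s > 0"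
  shows "((\<lambda>r. lens_avg n s R r) has_real_derivative
    unit_ball_vol (real (n - 1)) / unit_ball_vol (real n) * ((s / R) ^ (n - 1) * slope n (s / R) / R)) (at R)"
proof -
  let ?w = "unit_ball_vol (real (n - 1)) / unit_ball_vol (real n)"
  let ?b = "s / R"
  \<comment> \<open>The two caps of a lens share their base disc, so at \<open>r = R\<close> their
    \<open>profile\<close> values differ by the factor \<open>(s / R) ^ (n - 1)\<close>. This lets
    all terms combine into \<open>slope\<close>.\<close>
  have p: "profile n ((R\<^sup>2 + R\<^sup>2 - s\<^sup>2) / (2 * R * R)) = ?b ^ (n - 1) * profile n (?b / 2)"
  proof -
    have "1 - ((R\<^sup>2 + R\<^sup>2 - s\<^sup>2) / (2 * R * R))\<^sup>2 = ?b\<^sup>2 * (1 - (?b / 2)\<^sup>2)"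
      using assms by (simp add: divide_simps) (simp add: algebra_simps power2_eq_square)
    moreover have "max 0 (?b\<^sup>2 * (1 - (?b / 2)\<^sup>2)) = ?b\<^sup>2 * max 0 (1 - (?b / 2)\<^sup>2)"
      using assms by (simp add: max_mult_distrib_left)
    ultimately have "sqrt (max 0 (1 - ((R\<^sup>2 + R\<^sup>2 - s\<^sup>2) / (2 * R * R))\<^sup>2)) = ?b * sqrt (max 0 (1 - (?b / 2)\<^sup>2))"
      using assms by (simp only: real_sqrt_mult) simp
    then show ?thesis unfolding profile_def by (simp only: power_mult_distrib)
  qed
  have h: "(R\<^sup>2 + s\<^sup>2 - R\<^sup>2) / (2 * R * s) = ?b / 2"
    using assms by (simp add: power2_eq_square)
  have 1: "((\<lambda>r. (R\<^sup>2 + r\<^sup>2 - s\<^sup>2) / (2 * R * r)) has_real_derivative ?b\<^sup>2 / (2 * R)) (at R)"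
    using assms by (auto intro!: derivative_eq_intros) (simp add: divide_simps power2_eq_square; simp add: algebra_simps)
  have 2: "((\<lambda>r. (R\<^sup>2 + s\<^sup>2 - r\<^sup>2) / (2 * R * s)) has_real_derivative - 1 / s) (at R)"
    using assms by (auto intro!: derivative_eq_intros)
  have 3: "((\<lambda>r. (s / r) ^ n) has_real_derivative (real n * (?b ^ (n - 1) * (- s / R\<^sup>2)))) (at R)"
    using assms by (auto intro!: derivative_eq_intros simp: power2_eq_square)
  have "((\<lambda>r. lens_avg n s R r) has_real_derivative
     ?w * (- profile n ((R\<^sup>2 + R\<^sup>2 - s\<^sup>2) / (2 * R * R)) * (?b\<^sup>2 / (2 * R)) +
     (real n * (?b ^ (n - 1) * (- s / R\<^sup>2)) * cap n ((R\<^sup>2 + s\<^sup>2 - R\<^sup>2) / (2 * R * s))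
      + - profile n ((R\<^sup>2 + s\<^sup>2 - R\<^sup>2) / (2 * R * s)) * (- 1 / s) * ?b ^ n))) (at R)"
    unfolding lens_avg_def
    by (intro DERIV_cmult DERIV_add DERIV_mult cap_has_derivative_chain 1 2 3)
  also have "(- profile n ((R\<^sup>2 + R\<^sup>2 - s\<^sup>2) / (2 * R * R)) * (?b\<^sup>2 / (2 * R)) +
     (real n * (?b ^ (n - 1) * (- s / R\<^sup>2)) * cap n ((R\<^sup>2 + s\<^sup>2 - R\<^sup>2) / (2 * R * s))
      + - profile n ((R\<^sup>2 + s\<^sup>2 - R\<^sup>2) / (2 * R * s)) * (- 1 / s) * ?b ^ n))
      = ?b ^ (n - 1) * slope n ?b / R"
  proof -
    have "?b ^ n = ?b ^ (n - 1) * ?b" using assms by (cases n) auto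
    then show ?thesis unfolding p h slope_def using assms
      by (simp add: divide_simps power2_eq_square) (simp add: algebra_simps)
  qed
  finally show ?thesis .
qed

lemma shells_avg_has_derivative:
  assumes "n \<ge> 1" "R > 0" "\<delta> > 0" "\<Lambda> > \<tau>" "\<tau> > 0"
  shows "((\<lambda>r. shells_avg n \<delta> \<tau> \<Lambda> R r) has_real_derivative
    unit_ball_vol (real (n - 1)) / unit_ball_vol (real n) * ((1 / R) ^ (n - 1) / R) *
     (annulus_slope n \<delta> (1 / R) + (\<Lambda> + \<tau>) ^ (n - 1) * slope n ((\<Lambda> + \<tau>) * (1 / R))
      - (\<Lambda> - \<tau>) ^ (n - 1) * slope n ((\<Lambda> - \<tau>) * (1 / R)))) (at R)"
proof -
  let ?w = "unit_ball_vol (real (n - 1)) / unit_ball_vol (real n)"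
  let ?d = "\<lambda>s. ?w * ((s / R) ^ (n - 1) * slope n (s / R) / R)"
  have "((\<lambda>r. shells_avg n \<delta> \<tau> \<Lambda> R r) has_real_derivative
    ?d 1 - ?d \<delta> + ?d (\<Lambda> + \<tau>) - ?d (\<Lambda> - \<tau>)) (at R)"
    unfolding shells_avg_def using assms
    by (intro DERIV_add DERIV_diff lens_avg_has_derivative) auto
  moreover have "?d s = ?w * ((1 / R) ^ (n - 1) / R) * (s ^ (n - 1) * slope n (s * (1 / R)))" for s
    by (simp add: power_divide)
  ultimately show ?thesis
    by (simp only: annulus_slope_def) (simp add: algebra_simps)
qed

lemma continuous_on_lens_avg:
  assumes "s > 0"
  shows "continuous_on ({0<..} \<times> {0<..}) (\<lambda>(R, r). lens_avg n s R r)"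
  unfolding lens_avg_def split_beta using assms
  by (intro continuous_intros) auto

lemma continuous_on_shells_avg:
  assumes "\<delta> > 0" "\<Lambda> > \<tau>" "\<tau> > 0"
  shows "continuous_on ({0<..} \<times> {0<..}) (\<lambda>(R, r). shells_avg n \<delta> \<tau> \<Lambda> R r)"
  using assms continuous_on_lens_avg[of 1 n] continuous_on_lens_avg[of \<delta> n]
    continuous_on_lens_avg[of "\<Lambda> + \<tau>" n] continuous_on_lens_avg[of "\<Lambda> - \<tau>" n]
  unfolding shells_avg_def split_beta
  by (intro continuous_intros) auto

lemma measure_lens_avg:
  fixes X :: "real ^ 'n"
  assumes "X \<noteq> 0" "CARD('n) \<ge> 2" "r > 0" "s > 0"
  shows "measure lebesgue (ball X r \<inter> ball 0 s)
    = unit_ball_vol (real CARD('n)) * r ^ CARD('n) * lens_avg CARD('n) s (norm X) r"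
proof -
  have "unit_ball_vol (real CARD('n)) \<noteq> 0" by (metis less_irrefl of_nat_0_le_iff unit_ball_vol_pos)
  then show ?thesis
    unfolding measure_lens[OF assms] lens_avg_def using assms
    by (simp add: power_divide field_simps)
qed

lemma measure_lebesgue_ball:
  "r \<ge> 0 \<Longrightarrow> measure lebesgue (ball (X :: 'a::euclidean_space) r) = unit_ball_vol (real DIM('a)) * r ^ DIM('a)"
  by (simp add: content_ball)

section \<open>Integrals and averages over balls\<close>

definition ball_mass :: "('a::euclidean_space \<Rightarrow> real) \<Rightarrow> 'a \<Rightarrow> real \<Rightarrow> real"
  where "ball_mass \<phi> X r = (LINT y:ball X r|lebesgue. \<phi> y)"

text \<open>Real-valued and without absolute values. For nonnegative integrable functions its
  supremum over \<open>r\<close> is \<open>central_maximal\<close>.\<close>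

definition ball_avg :: "('a::euclidean_space \<Rightarrow> real) \<Rightarrow> 'a \<Rightarrow> real \<Rightarrow> real"
  where "ball_avg \<phi> X r = ball_mass \<phi> X r / (unit_ball_vol (real DIM('a)) * r ^ DIM('a))"

lemma ball_integrable: "integrable lebesgue \<phi> \<Longrightarrow> set_integrable lebesgue (ball X r) (\<phi> :: 'a::euclidean_space \<Rightarrow> real)"
  unfolding set_integrable_def by (rule integrable_mult_indicator) auto

lemma ball_mass_indicator:
  "A \<in> sets lebesgue \<Longrightarrow> ball_mass (indicator A) X r = measure lebesgue (ball X r \<inter> A)"
  unfolding ball_mass_def set_lebesgue_integral_def
  by (simp add: indicator_inter_arith[symmetric])

lemma ball_mass_add:
  "integrable lebesgue \<phi> \<Longrightarrow> integrable lebesgue \<psi> \<Longrightarrow>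
    ball_mass (\<lambda>y. \<phi> y + \<psi> y) X r = ball_mass \<phi> X r + ball_mass \<psi> X r"
  unfolding ball_mass_def by (intro set_integral_add ball_integrable)

lemma ball_mass_le_measure:
  assumes "integrable lebesgue \<phi>" "A \<in> lmeasurable" "\<And>y. y \<in> ball X r \<Longrightarrow> \<phi> y \<le> indicator A y"
  shows "ball_mass \<phi> X r \<le> measure lebesgue A"
proof -
  have int: "integrable lebesgue (indicator A :: 'a \<Rightarrow> real)"
    using assms by (auto simp: fmeasurable_def)
  have "ball_mass \<phi> X r \<le> ball_mass (indicator A) X r"
    unfolding ball_mass_def using assms int by (intro set_integral_mono ball_integrable) auto
  also have "\<dots> = measure lebesgue (ball X r \<inter> A)"
    using assms by (intro ball_mass_indicator) auto
  also have "\<dots> \<le> measure lebesgue A"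
    using assms by (intro measure_mono_fmeasurable) auto
  finally show ?thesis .
qed

lemma measure_le_ball_mass:
  assumes "integrable lebesgue \<phi>" "A \<in> lmeasurable" "A \<subseteq> ball X r" "\<And>y. y \<in> ball X r \<Longrightarrow> indicator A y \<le> \<phi> y"
  shows "measure lebesgue A \<le> ball_mass \<phi> X r"
proof -
  have int: "integrable lebesgue (indicator A :: 'a \<Rightarrow> real)"
    using assms by (auto simp: fmeasurable_def)
  have "measure lebesgue A = ball_mass (indicator A) X r"
    using assms by (subst ball_mass_indicator) (auto simp: Int_absorb1)
  also have "\<dots> \<le> ball_mass \<phi> X r"
    unfolding ball_mass_def using assms int by (intro set_integral_mono ball_integrable) auto
  finally show ?thesis .
qed

lemma open_shell: "open {y :: 'a::real_normed_vector. a < norm y \<and> norm y < b}"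
  by (intro open_Collect_conj open_Collect_less continuous_intros)

lemma lmeasurable_shell: "{y :: 'a::euclidean_space. a < norm y \<and> norm y < b} \<in> lmeasurable"
proof (rule lmeasurable_open)
  show "bounded {y :: 'a. a < norm y \<and> norm y < b}"
    by (rule bounded_subset[OF bounded_ball[of 0 b]]) auto
qed (rule open_shell)

lemma integrable_two_shells: "integrable lebesgue (two_shells \<delta> \<tau> \<Lambda> :: 'a::euclidean_space \<Rightarrow> real)"
  unfolding two_shells_def[abs_def] using lmeasurable_shell[where 'a='a]
  by (intro Bochner_Integration.integrable_add integrable_real_indicator) (auto simp: fmeasurable_def)

lemma measure_ball_shell:
  assumes "a < b" "a \<ge> 0"
  shows "measure lebesgue (ball X r \<inter> {y :: 'a::euclidean_space. a < norm y \<and> norm y < b})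
    = measure lebesgue (ball X r \<inter> ball 0 b) - measure lebesgue (ball X r \<inter> ball 0 a)"
proof -
  have "ball X r \<inter> {y :: 'a. a < norm y \<and> norm y < b} = ball X r \<inter> ball 0 b - ball X r \<inter> cball 0 a"
    by auto
  also have "measure lebesgue \<dots> = measure lebesgue (ball X r \<inter> ball 0 b) - measure lebesgue (ball X r \<inter> cball 0 a)"
    using assms by (intro measurable_measure_Diff fmeasurable.Int) auto
  also have "measure lebesgue (ball X r \<inter> cball 0 a) = measure lebesgue (ball X r \<inter> ball 0 a)"
  proof (rule measure_negligible_symdiff)
    show "negligible (sym_diff (ball X r \<inter> ball 0 a) (ball X r \<inter> cball 0 a))"
      by (rule negligible_subset[OF negligible_sphere[of 0 a]]) auto
  qed (intro fmeasurable.Int; simp)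
  finally show ?thesis .
qed

lemma ball_avg_two_shells:
  fixes X :: "real ^ 'n"
  assumes "X \<noteq> 0" "CARD('n) \<ge> 2" "r > 0" "0 < \<delta>" "\<delta> < 1" "\<tau> > 0" "\<Lambda> > \<tau>"
  shows "ball_avg (two_shells \<delta> \<tau> \<Lambda>) X r = shells_avg CARD('n) \<delta> \<tau> \<Lambda> (norm X) r"
proof -
  have pos: "unit_ball_vol (real CARD('n)) \<noteq> 0" by (metis less_irrefl of_nat_0_le_iff unit_ball_vol_pos)
  have int: "integrable lebesgue (indicator {y :: real ^ 'n. a < norm y \<and> norm y < b} :: _ \<Rightarrow> real)" for a b
    using lmeasurable_shell[of a b, where 'a="real ^ 'n"] by (auto simp: fmeasurable_def)
  have "ball_mass (two_shells \<delta> \<tau> \<Lambda>) X r = measure lebesgue (ball X r \<inter> {y. \<delta> < norm y \<and> norm y < 1})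
      + measure lebesgue (ball X r \<inter> {y. \<Lambda> - \<tau> < norm y \<and> norm y < \<Lambda> + \<tau>})"
    unfolding two_shells_def[abs_def] using int
    by (simp add: ball_mass_add ball_mass_indicator lebesgue_openin open_shell)
  also have "\<dots> = unit_ball_vol (real CARD('n)) * r ^ CARD('n) * shells_avg CARD('n) \<delta> \<tau> \<Lambda> (norm X) r"
  proof -
    have "measure lebesgue (ball X r \<inter> {y. \<delta> < norm y \<and> norm y < 1})
        = measure lebesgue (ball X r \<inter> ball 0 1) - measure lebesgue (ball X r \<inter> ball 0 \<delta>)"
      using assms by (intro measure_ball_shell) auto
    moreover have "measure lebesgue (ball X r \<inter> {y. \<Lambda> - \<tau> < norm y \<and> norm y < \<Lambda> + \<tau>})
        = measure lebesgue (ball X r \<inter> ball 0 (\<Lambda> + \<tau>)) - measure lebesgue (ball X r \<inter> ball 0 (\<Lambda> - \<tau>))"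
      using assms by (intro measure_ball_shell) auto
    moreover have "measure lebesgue (ball X r \<inter> ball 0 s)
        = unit_ball_vol (real CARD('n)) * r ^ CARD('n) * lens_avg CARD('n) s (norm X) r" if "s > 0" for s
      using assms that by (intro measure_lens_avg) auto
    ultimately show ?thesis
      using assms unfolding shells_avg_def by (simp only:) (simp add: algebra_simps del: measure_completion)
  qed
  finally show ?thesis using pos assms by (simp add: ball_avg_def)
qed

section \<open>Comparison of averages, first for a single radius and then uniformly\<close>

lemma two_shells_nonneg: "two_shells \<delta> \<tau> \<Lambda> y \<ge> 0"
  by (simp add: two_shells_def)

lemma two_shells_le_1: "\<Lambda> > 1 + \<tau> \<Longrightarrow> two_shells \<delta> \<tau> \<Lambda> y \<le> 1"
  by (auto simp: two_shells_def indicator_def)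

lemma ball_avg_two_shells_ge:
  fixes X :: "'a::euclidean_space"
  assumes "A \<in> lmeasurable" "A \<subseteq> ball X r" "\<And>y. y \<in> A \<Longrightarrow> two_shells \<delta> \<tau> \<Lambda> y \<ge> 1" "r > 0"
    "measure lebesgue A \<ge> m * (unit_ball_vol (real DIM('a)) * r ^ DIM('a))"
  shows "ball_avg (two_shells \<delta> \<tau> \<Lambda>) X r \<ge> m"
proof -
  have "measure lebesgue A \<le> ball_mass (two_shells \<delta> \<tau> \<Lambda>) X r"
    using assms two_shells_nonneg by (intro measure_le_ball_mass integrable_two_shells)
      (auto simp: indicator_def)
  then show ?thesis using assms by (simp add: ball_avg_def pos_le_divide_eq)
qed

text \<open>The ball of radius \<open>p\<close> centred at distance \<open>p\<close> from the origin
  towards \<open>X\<close> lies both in \<open>ball X (norm X)\<close> and in the hole of radius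
  \<delta>, where the shells contribute nothing.\<close>

lemma ball_avg_two_shells_through_origin:
  fixes X :: "'a::euclidean_space"
  assumes p: "p > 0" "2 * p \<le> \<delta>" "p \<le> norm X" "\<Lambda> > 1 + \<tau>" "\<delta> < 1" "\<tau> > 0"
  shows "ball_avg (two_shells \<delta> \<tau> \<Lambda>) X (norm X) \<le> 1 - (p / norm X) ^ DIM('a)"
proof -
  define R where "R = norm X"
  have R: "R > 0" using p unfolding R_def by linarith
  define z where "z = (p / R) *\<^sub>R X"
  have z: "norm z = p" using p R by (simp add: z_def R_def)
  have "X - z = (1 - p / R) *\<^sub>R X" by (simp add: z_def algebra_simps)
  then have "norm (X - z) = \<bar>1 - p / R\<bar> * R" by (simp add: R_def)
  moreover have "p / R \<le> 1" using p R by (simp add: R_def)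
  ultimately have Xz: "norm (X - z) = R - p" using R by (simp add: left_diff_distrib)
  have sub: "ball z p \<subseteq> ball X R"
  proof
    fix y assume "y \<in> ball z p"
    then show "y \<in> ball X R" using Xz dist_triangle[of X y z] by (simp add: dist_norm)
  qed
  have sub0: "norm y < \<delta>" if "y \<in> ball z p" for y
    using that z p norm_triangle_sub[of y z] by (simp add: dist_norm norm_minus_commute)
  have "ball_mass (two_shells \<delta> \<tau> \<Lambda>) X R \<le> measure lebesgue (ball X R - ball z p)"
  proof (rule ball_mass_le_measure)
    fix y assume "y \<in> ball X R"
    then show "two_shells \<delta> \<tau> \<Lambda> y \<le> indicator (ball X R - ball z p) y"
      using two_shells_le_1[OF p(4), of \<delta> y] sub0[of y] p by (auto simp: indicator_def two_shells_def)
  qed (auto intro!: integrable_two_shells fmeasurable.Diff)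
  also have "\<dots> = measure lebesgue (ball X R) - measure lebesgue (ball z p)"
    using sub by (intro measurable_measure_Diff) auto
  also have "\<dots> = (1 - (p / R) ^ DIM('a)) * (unit_ball_vol (real DIM('a)) * R ^ DIM('a))"
    using p R by (simp add: measure_lebesgue_ball field_simps power_divide content_ball)
  finally show ?thesis using R by (simp add: ball_avg_def pos_divide_le_eq R_def)
qed

text \<open>\<open>R\<close> is realised as the norm of a vector, so that direct volume estimates
  serve in the hole and in the shells, and the derivative of the explicit formula serves
  elsewhere.\<close>

lemma shells_avg_improve:
  assumes card: "CARD('n::finite) \<ge> 4"
    and \<delta>: "0 < \<delta>" "\<delta> \<le> 1 / 16"
    and shell: "\<tau> > 0" "\<Lambda> > 1 + \<tau>"
    and crit: "\<And>a. 0 < a \<Longrightarrow> a \<le> 1 \<Longrightarrow> \<Lambda> * a \<noteq> 1 \<Longrightarrow>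
       annulus_slope CARD('n) \<delta> a + (\<Lambda> + \<tau>) ^ (CARD('n) - 1) * slope CARD('n) ((\<Lambda> + \<tau>) * a)
        - (\<Lambda> - \<tau>) ^ (CARD('n) - 1) * slope CARD('n) ((\<Lambda> - \<tau>) * a) \<noteq> 0"
    and R: "R > 0"
  obtains r' where "r' > 0" "r' \<noteq> R"
    "shells_avg CARD('n) \<delta> \<tau> \<Lambda> R r' > shells_avg CARD('n) \<delta> \<tau> \<Lambda> R R"
proof -
  note found = that
  let ?n = "CARD('n)"
  obtain X :: "real ^ 'n" where X: "norm X = R"
    using vector_choose_size[of R] R by auto
  have X0: "X \<noteq> 0" using X R by auto
  have avg: "shells_avg ?n \<delta> \<tau> \<Lambda> R r = ball_avg (two_shells \<delta> \<tau> \<Lambda>) X r" if "r > 0" for r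
    using ball_avg_two_shells[OF X0 _ that] \<delta> shell X card by simp
  have in_shell: ?thesis if e: "\<And>y :: real ^ 'n. norm X - e < norm y \<Longrightarrow> norm y < norm X + e \<Longrightarrow> two_shells \<delta> \<tau> \<Lambda> y \<ge> 1"
    and "e > 0" and "R > \<delta>" for e
  proof -
    \<comment> \<open>The bound \<open>R / 2\<close> ensures \<open>r' \<noteq> R\<close>.\<close>
    define r' where "r' = min e (R / 2)"
    have r': "r' > 0" "r' \<noteq> R" "r' \<le> e" using that R by (auto simp: r'_def)
    have "ball_avg (two_shells \<delta> \<tau> \<Lambda>) X r' \<ge> 1"
    proof (rule ball_avg_two_shells_ge[of "ball X r'"])
      fix y :: "real ^ 'n" assume "y \<in> ball X r'"
      then have "norm (X - y) < e" using r' by (simp add: dist_norm)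
      then show "two_shells \<delta> \<tau> \<Lambda> y \<ge> 1"
        using norm_triangle_ineq2[of X y] norm_triangle_ineq2[of y X] by (intro e) (auto simp: norm_minus_commute)
    qed (use r' in \<open>auto simp: measure_lebesgue_ball content_ball\<close>)
    moreover have "ball_avg (two_shells \<delta> \<tau> \<Lambda>) X R < 1"
    proof -
      have "ball_avg (two_shells \<delta> \<tau> \<Lambda>) X R \<le> 1 - (\<delta> / 2 / R) ^ DIM(real ^ 'n)"
        using ball_avg_two_shells_through_origin[of "\<delta> / 2" \<delta> X \<tau> \<Lambda>] X that \<delta> shell R by simp
      moreover have "(\<delta> / 2 / R) ^ DIM(real ^ 'n) > 0" using \<delta> R by (intro zero_less_power) auto
      ultimately show ?thesis by linarith
    qed
    ultimately show ?thesis using that(1) r' R by (intro found[of r']) (auto simp: avg)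
  qed
  consider "R \<le> \<delta>" | "\<delta> < R" "R < 1" | "\<Lambda> - \<tau> < R" "R < \<Lambda> + \<tau>" | "R \<ge> 1" "\<Lambda> * (1 / R) \<noteq> 1"
  proof -
    \<comment> \<open>The one point excluded in \<open>crit\<close>, \<open>R = \<Lambda>\<close>,
      lies inside the second shell.\<close>
    have "\<Lambda> - \<tau> < R \<and> R < \<Lambda> + \<tau>" if "\<Lambda> * (1 / R) = 1"
      using that R shell by (simp add: field_simps)
    then show ?thesis using that by argo
  qed
  then show ?thesis
  proof cases
    case 1
    \<comment> \<open>The largest ball about \<open>X\<close> inside the unit ball. It misses only
      the hole, a proportion below \<open>(1 / 2) ^ n\<close>, while \<open>ball X R\<close> misses
      at least that proportion by the previous lemma with \<open>p = R / 2\<close>.\<close>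
    define r' where "r' = 1 - R"
    have r': "r' > 0" "r' \<noteq> R" "\<delta> / r' < 1 / 2"
      using 1 \<delta> by (auto simp: r'_def divide_simps)
    have "ball_avg (two_shells \<delta> \<tau> \<Lambda>) X r' \<ge> 1 - (\<delta> / r') ^ ?n"
    proof (rule ball_avg_two_shells_ge[of "ball X r' - cball 0 \<delta>"])
      fix y :: "real ^ 'n" assume y: "y \<in> ball X r' - cball 0 \<delta>"
      then have "norm y < 1"
        using X norm_triangle_sub[of y X] by (simp add: r'_def dist_norm norm_minus_commute)
      then show "two_shells \<delta> \<tau> \<Lambda> y \<ge> 1" using y shell by (auto simp: two_shells_def)
    next
      have "cball 0 \<delta> \<subseteq> ball X r'"
      proof
        fix y :: "real ^ 'n" assume "y \<in> cball 0 \<delta>"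
        then show "y \<in> ball X r'" using 1 X \<delta> norm_triangle_ineq4[of X y]
          by (simp add: r'_def dist_norm)
      qed
      then have "measure lebesgue (ball X r' - cball 0 \<delta>) = measure lebesgue (ball X r') - measure lebesgue (cball (0 :: real ^ 'n) \<delta>)"
        by (intro measurable_measure_Diff) auto
      also have "\<dots> = (1 - (\<delta> / r') ^ ?n) * (unit_ball_vol (real ?n) * r' ^ ?n)"
        using r' \<delta> by (simp add: content_ball content_cball field_simps power_divide)
      finally show "(1 - (\<delta> / r') ^ ?n) * (unit_ball_vol (real DIM(real ^ 'n)) * r' ^ DIM(real ^ 'n))
          \<le> measure lebesgue (ball X r' - cball 0 \<delta>)" by simp
    qed (use r' in \<open>auto intro!: fmeasurable.Diff\<close>)
    moreover have "(\<delta> / r') ^ ?n < (1 / 2) ^ ?n"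
      using r' \<delta> by (intro power_strict_mono) auto
    moreover have "ball_avg (two_shells \<delta> \<tau> \<Lambda>) X R \<le> 1 - (1 / 2) ^ ?n"
      using ball_avg_two_shells_through_origin[of "R / 2" \<delta> X \<tau> \<Lambda>] X 1 \<delta> shell R by simp
    ultimately show ?thesis using r' R by (intro found[of r']) (auto simp: avg)
  next
    case 2
    show ?thesis
    proof (rule in_shell[of "min (R - \<delta>) (1 - R)"])
      fix y :: "real ^ 'n"
      assume "norm X - min (R - \<delta>) (1 - R) < norm y" "norm y < norm X + min (R - \<delta>) (1 - R)"
      then show "two_shells \<delta> \<tau> \<Lambda> y \<ge> 1" using X by (auto simp: two_shells_def min_def split: if_splits)
    qed (use 2 in auto)
  next
    case 3
    show ?thesis
    proof (rule in_shell[of "min (R - (\<Lambda> - \<tau>)) (\<Lambda> + \<tau> - R)"])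
      fix y :: "real ^ 'n"
      assume "norm X - min (R - (\<Lambda> - \<tau>)) (\<Lambda> + \<tau> - R) < norm y"
        "norm y < norm X + min (R - (\<Lambda> - \<tau>)) (\<Lambda> + \<tau> - R)"
      then show "two_shells \<delta> \<tau> \<Lambda> y \<ge> 1" using X by (auto simp: two_shells_def min_def split: if_splits)
    qed (use 3 \<delta> shell in auto)
  next
    case 4
    let ?E = "annulus_slope ?n \<delta> (1 / R) + (\<Lambda> + \<tau>) ^ (?n - 1) * slope ?n ((\<Lambda> + \<tau>) * (1 / R))
      - (\<Lambda> - \<tau>) ^ (?n - 1) * slope ?n ((\<Lambda> - \<tau>) * (1 / R))"
    let ?D = "unit_ball_vol (real (?n - 1)) / unit_ball_vol (real ?n) * ((1 / R) ^ (?n - 1) / R) * ?E"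
    have deriv: "(shells_avg ?n \<delta> \<tau> \<Lambda> R has_real_derivative ?D) (at R)"
      using shells_avg_has_derivative[of ?n R \<delta> \<tau> \<Lambda>] card R \<delta> shell by simp
    have "?E \<noteq> 0" using crit[of "1 / R"] 4 R by simp
    moreover have "unit_ball_vol (real (?n - 1)) / unit_ball_vol (real ?n) * ((1 / R) ^ (?n - 1) / R) > 0"
      using R by (intro mult_pos_pos divide_pos_pos) auto
    ultimately have "?D \<noteq> 0" by (metis less_irrefl mult_eq_0_iff)
    \<comment> \<open>A nonzero derivative gives a larger average slightly to the right or slightly
      to the left of \<open>R\<close>.\<close>
    then consider "?D > 0" | "?D < 0" by linarith
    then show ?thesis
    proof cases
      case 1
      from DERIV_pos_inc_right[OF deriv this] obtain d where d: "d > 0"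
        "\<And>h. h > 0 \<Longrightarrow> h < d \<Longrightarrow> shells_avg ?n \<delta> \<tau> \<Lambda> R R < shells_avg ?n \<delta> \<tau> \<Lambda> R (R + h)" by blast
      then show ?thesis using R by (intro found[of "R + d / 2"]) auto
    next
      case 2
      from DERIV_neg_dec_left[OF deriv this] obtain d where d: "d > 0"
        "\<And>h. h > 0 \<Longrightarrow> h < d \<Longrightarrow> shells_avg ?n \<delta> \<tau> \<Lambda> R R < shells_avg ?n \<delta> \<tau> \<Lambda> R (R - h)" by blast
      then show ?thesis using R by (intro found[of "R - min (d / 2) (R / 2)"]) auto
    qed
  qed
qed

lemma ball_avg_gap_near:
  fixes R0 :: real
  assumes card: "CARD('n::finite) \<ge> 2"
    and \<delta>: "0 < \<delta>" "\<delta> \<le> 1 / 16" and shell: "\<tau> > 0" "\<Lambda> > 1 + \<tau>"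
    and improve: "\<And>R. R > 0 \<Longrightarrow> \<exists>r'>0. r' \<noteq> R \<and>
      shells_avg CARD('n) \<delta> \<tau> \<Lambda> R R < shells_avg CARD('n) \<delta> \<tau> \<Lambda> R r'"
    and R0: "R0 \<ge> 0"
  obtains \<rho> where "\<rho> > 0" "\<And>(X :: real ^ 'n) r. r > 0 \<Longrightarrow> \<bar>norm X - R0\<bar> < \<rho> \<Longrightarrow> \<bar>r - norm X\<bar> < \<rho> \<Longrightarrow>
    \<exists>r'>0. \<bar>r' - norm X\<bar> \<ge> \<rho> \<and>
      ball_avg (two_shells \<delta> \<tau> \<Lambda>) X r + \<rho> \<le> ball_avg (two_shells \<delta> \<tau> \<Lambda>) X r'"
proof (cases "R0 = 0")
  case True
  \<comment> \<open>With this value \<open>norm X + r < \<delta>\<close>, so the ball does not meet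
    the shells.\<close>
  show ?thesis
  proof (rule that[of "\<delta> / 3"])
    fix X :: "real ^ 'n" and r :: real
    assume r: "r > 0" "\<bar>norm X - R0\<bar> < \<delta> / 3" "\<bar>r - norm X\<bar> < \<delta> / 3"
    then have X: "norm X < \<delta> / 3" "r < 2 * \<delta> / 3" using True by linarith+
    have "ball_mass (two_shells \<delta> \<tau> \<Lambda>) X r \<le> measure lebesgue ({} :: (real ^ 'n) set)"
    proof (rule ball_mass_le_measure)
      fix y assume "y \<in> ball X r"
      then have "norm y < \<delta>"
        using X norm_triangle_sub[of y X] by (simp add: dist_norm norm_minus_commute)
      then show "two_shells \<delta> \<tau> \<Lambda> y \<le> indicator {} y"
        using \<delta> shell by (simp add: two_shells_def)
    qed (auto intro: integrable_two_shells)
    then have 1: "ball_avg (two_shells \<delta> \<tau> \<Lambda>) X r \<le> 0"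
      using r by (simp add: ball_avg_def divide_nonpos_nonneg)
    have "ball_avg (two_shells \<delta> \<tau> \<Lambda>) X (1/2) \<ge> 1 - (2 * \<delta>) ^ CARD('n)"
    proof (rule ball_avg_two_shells_ge[of "ball X (1/2) - cball 0 \<delta>"])
      fix y assume y: "y \<in> ball X (1/2) - cball 0 \<delta>"
      then have "norm y < 1"
        using X \<delta> norm_triangle_sub[of y X] by (simp add: dist_norm norm_minus_commute)
      then show "two_shells \<delta> \<tau> \<Lambda> y \<ge> 1" using y shell by (auto simp: two_shells_def)
    next
      have "cball 0 \<delta> \<subseteq> ball X (1/2)"
      proof
        fix y :: "real ^ 'n" assume "y \<in> cball 0 \<delta>"
        then show "y \<in> ball X (1/2)" using X \<delta> norm_triangle_ineq4[of X y]
          by (simp add: dist_norm)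
      qed
      then have "measure lebesgue (ball X (1/2) - cball 0 \<delta>)
          = measure lebesgue (ball X (1/2)) - measure lebesgue (cball (0 :: real ^ 'n) \<delta>)"
        by (intro measurable_measure_Diff) auto
      also have "\<dots> = (1 - (2 * \<delta>) ^ CARD('n)) * (unit_ball_vol (real CARD('n)) * (1/2) ^ CARD('n))"
        using \<delta> by (simp add: content_ball content_cball field_simps power_divide power_mult_distrib)
      finally show "(1 - (2 * \<delta>) ^ CARD('n)) * (unit_ball_vol (real DIM(real ^ 'n)) * (1/2) ^ DIM(real ^ 'n))
          \<le> measure lebesgue (ball X (1/2) - cball 0 \<delta>)" by simp
    qed (auto intro!: fmeasurable.Diff)
    moreover have "(2 * \<delta>) ^ CARD('n) \<le> 2 * \<delta>"
      using power_decreasing[of 1 "CARD('n)" "2 * \<delta>"] \<delta> card by simp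
    ultimately have "ball_avg (two_shells \<delta> \<tau> \<Lambda>) X (1/2) \<ge> \<delta> / 3" using \<delta> by simp
    moreover have "\<bar>1/2 - norm X\<bar> \<ge> \<delta> / 3" using X \<delta> norm_ge_zero[of X] by linarith
    ultimately show "\<exists>r'>0. \<bar>r' - norm X\<bar> \<ge> \<delta> / 3 \<and>
      ball_avg (two_shells \<delta> \<tau> \<Lambda>) X r + \<delta> / 3 \<le> ball_avg (two_shells \<delta> \<tau> \<Lambda>) X r'"
      using 1 by (intro exI[of _ "1/2"]) auto
  qed (use \<delta> in auto)
next
  case False
  then have R0: "R0 > 0" using R0 by simp
  let ?\<Phi> = "\<lambda>R r. shells_avg CARD('n) \<delta> \<tau> \<Lambda> R r"
  obtain r' where r': "r' > 0" "r' \<noteq> R0" "?\<Phi> R0 R0 < ?\<Phi> R0 r'"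
    using improve[OF R0] by blast
  \<comment> \<open>A third of the gap: two deviations below \<open>d\<close> leave at least
    \<open>d\<close>.\<close>
  define d where "d = (?\<Phi> R0 r' - ?\<Phi> R0 R0) / 3"
  have d: "d > 0" using r' by (simp add: d_def)
  have near: "\<exists>e>0. \<forall>R r. \<bar>R - R0\<bar> < e \<longrightarrow> \<bar>r - r0\<bar> < e \<longrightarrow> \<bar>?\<Phi> R r - ?\<Phi> R0 r0\<bar> < d" if r0: "r0 > 0" for r0
  proof -
    have "continuous_on ({0<..} \<times> {0<..}) (\<lambda>(R, r). ?\<Phi> R r)"
      using \<delta> shell by (intro continuous_on_shells_avg) auto
    moreover have "open ({0<..} \<times> {0<..} :: (real \<times> real) set)" by (intro open_Times) auto
    ultimately have "isCont (\<lambda>(R, r). ?\<Phi> R r) (R0, r0)"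
      using R0 r0 by (simp add: continuous_on_eq_continuous_at)
    then obtain e where e: "e > 0" "\<And>p. dist p (R0, r0) < e \<Longrightarrow> dist ((\<lambda>(R, r). ?\<Phi> R r) p) (?\<Phi> R0 r0) < d"
      using d unfolding continuous_at_eps_delta by (metis (mono_tags, lifting) case_prod_conv)
    show ?thesis
    proof (intro exI conjI allI impI)
      fix R r assume "\<bar>R - R0\<bar> < e / 2" "\<bar>r - r0\<bar> < e / 2"
      then have "dist (R, r) (R0, r0) < e"
        using sqrt_sum_squares_le_sum_abs[of "R - R0" "r - r0"]
        by (simp add: dist_Pair_Pair dist_real_def)
      from e(2)[OF this] show "\<bar>?\<Phi> R r - ?\<Phi> R0 r0\<bar> < d" by (simp add: dist_real_def)
    qed (use e in auto)
  qed
  obtain e1 where e1: "e1 > 0" "\<And>R r. \<bar>R - R0\<bar> < e1 \<Longrightarrow> \<bar>r - R0\<bar> < e1 \<Longrightarrow> \<bar>?\<Phi> R r - ?\<Phi> R0 R0\<bar> < d"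
    using near[OF R0] by blast
  obtain e2 where e2: "e2 > 0" "\<And>R r. \<bar>R - R0\<bar> < e2 \<Longrightarrow> \<bar>r - r'\<bar> < e2 \<Longrightarrow> \<bar>?\<Phi> R r - ?\<Phi> R0 r'\<bar> < d"
    using near[OF r'(1)] by blast
  \<comment> \<open>\<open>e1 / 2\<close> is taken because \<open>r\<close> may be
    \<open>2 * \<rho>\<close> away from \<open>R0\<close>; \<open>\<bar>r' - R0\<bar> / 2\<close>
    keeps \<open>r'\<close> at distance \<rho> from \<open>norm X\<close>; \<open>R0 / 2\<close>
    keeps \<open>X\<close> nonzero.\<close>
  define \<rho> where "\<rho> = Min {e1 / 2, e2, d, \<bar>r' - R0\<bar> / 2, R0 / 2}"
  have \<rho>: "\<rho> > 0" "\<rho> \<le> e1 / 2" "\<rho> \<le> e2" "\<rho> \<le> d" "\<rho> \<le> \<bar>r' - R0\<bar> / 2" "\<rho> \<le> R0 / 2"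
  proof -
    have "\<rho> \<in> {e1 / 2, e2, d, \<bar>r' - R0\<bar> / 2, R0 / 2}"
      unfolding \<rho>_def by (rule Min_in) auto
    then show "\<rho> > 0" using e1 e2 d r' R0 by auto
    have "\<rho> \<le> x" if "x \<in> {e1 / 2, e2, d, \<bar>r' - R0\<bar> / 2, R0 / 2}" for x
      using that unfolding \<rho>_def by (intro Min_le) auto
    then show "\<rho> \<le> e1 / 2" "\<rho> \<le> e2" "\<rho> \<le> d" "\<rho> \<le> \<bar>r' - R0\<bar> / 2" "\<rho> \<le> R0 / 2"
      by blast+
  qed
  show ?thesis
  proof (rule that[OF \<rho>(1)])
    fix X :: "real ^ 'n" and r :: real
    assume r: "r > 0" "\<bar>norm X - R0\<bar> < \<rho>" "\<bar>r - norm X\<bar> < \<rho>"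
    have "norm X > 0" using r(2) \<rho>(6) R0 by linarith
    then have X: "X \<noteq> 0" by auto
    have avg: "ball_avg (two_shells \<delta> \<tau> \<Lambda>) X s = ?\<Phi> (norm X) s" if "s > 0" for s
      using that X card \<delta> shell by (intro ball_avg_two_shells) auto
    have "\<bar>?\<Phi> (norm X) r - ?\<Phi> R0 R0\<bar> < d" using r \<rho> by (intro e1) linarith+
    moreover have "\<bar>?\<Phi> (norm X) r' - ?\<Phi> R0 r'\<bar> < d" using r \<rho> e2 by (intro e2(2)) auto
    ultimately have "?\<Phi> (norm X) r + \<rho> \<le> ?\<Phi> (norm X) r'" using \<rho>(4) unfolding d_def by argo
    moreover have "\<bar>r' - norm X\<bar> \<ge> \<rho>"
      using r(2) \<rho>(5) abs_triangle_ineq[of "r' - norm X" "norm X - R0"] by simp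
    ultimately show "\<exists>r'>0. \<bar>r' - norm X\<bar> \<ge> \<rho> \<and>
      ball_avg (two_shells \<delta> \<tau> \<Lambda>) X r + \<rho> \<le> ball_avg (two_shells \<delta> \<tau> \<Lambda>) X r'"
      using r r' by (intro exI[of _ r']) (auto simp: avg)
  qed
qed

text \<open>A finite subcover of \<open>{0..B}\<close> by the neighbourhoods from
  \<open>ball_avg_gap_near\<close> makes the gap uniform.\<close>

lemma ball_avg_gap_bounded:
  fixes B :: real
  assumes card: "CARD('n::finite) \<ge> 2"
    and \<delta>: "0 < \<delta>" "\<delta> \<le> 1 / 16" and shell: "\<tau> > 0" "\<Lambda> > 1 + \<tau>"
    and improve: "\<And>R. R > 0 \<Longrightarrow> \<exists>r'>0. r' \<noteq> R \<and>
      shells_avg CARD('n) \<delta> \<tau> \<Lambda> R R < shells_avg CARD('n) \<delta> \<tau> \<Lambda> R r'"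
  obtains \<rho> where "\<rho> > 0" "\<And>(X :: real ^ 'n) r. r > 0 \<Longrightarrow> norm X \<le> B \<Longrightarrow> \<bar>r - norm X\<bar> < \<rho> \<Longrightarrow>
    \<exists>r'>0. \<bar>r' - norm X\<bar> \<ge> \<rho> \<and>
      ball_avg (two_shells \<delta> \<tau> \<Lambda>) X r + \<rho> \<le> ball_avg (two_shells \<delta> \<tau> \<Lambda>) X r'"
proof -
  let ?P = "\<lambda>R0 \<rho>. \<rho> > 0 \<and> (\<forall>(X :: real ^ 'n) r. r > 0 \<longrightarrow> \<bar>norm X - R0\<bar> < \<rho> \<longrightarrow> \<bar>r - norm X\<bar> < \<rho> \<longrightarrow>
    (\<exists>r'>0. \<bar>r' - norm X\<bar> \<ge> \<rho> \<and>
      ball_avg (two_shells \<delta> \<tau> \<Lambda>) X r + \<rho> \<le> ball_avg (two_shells \<delta> \<tau> \<Lambda>) X r'))"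
  have "\<forall>R0\<in>{0..B}. \<exists>\<rho>. ?P R0 \<rho>"
  proof
    fix R0 assume "R0 \<in> {0..B}"
    then have "R0 \<ge> 0" by simp
    show "\<exists>\<rho>. ?P R0 \<rho>"
    proof (rule ball_avg_gap_near[OF card \<delta> shell improve \<open>R0 \<ge> 0\<close>])
      fix \<rho> :: real
      assume "\<rho> > 0" and gap: "\<And>(X :: real ^ 'n) r. r > 0 \<Longrightarrow> \<bar>norm X - R0\<bar> < \<rho> \<Longrightarrow> \<bar>r - norm X\<bar> < \<rho> \<Longrightarrow>
        \<exists>r'>0. \<bar>r' - norm X\<bar> \<ge> \<rho> \<and>
          ball_avg (two_shells \<delta> \<tau> \<Lambda>) X r + \<rho> \<le> ball_avg (two_shells \<delta> \<tau> \<Lambda>) X r'"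
      then show "\<exists>\<rho>. ?P R0 \<rho>" by (intro exI[of _ \<rho>] conjI allI impI gap)
    qed
  qed
  then obtain \<rho> where \<rho>: "\<And>R0. R0 \<in> {0..B} \<Longrightarrow> ?P R0 (\<rho> R0)" by metis
  have "{0..B} \<subseteq> (\<Union>R0\<in>{0..B}. ball R0 (\<rho> R0))"
  proof
    fix x assume x: "x \<in> {0..B}"
    then have "x \<in> ball x (\<rho> x)" using \<rho>[OF x] by simp
    with x show "x \<in> (\<Union>R0\<in>{0..B}. ball R0 (\<rho> R0))" by blast
  qed
  then obtain C where C: "C \<subseteq> {0..B}" "finite C" "{0..B} \<subseteq> (\<Union>R0\<in>C. ball R0 (\<rho> R0))"
    by (rule compactE_image[OF compact_Icc open_ball]) blast
  \<comment> \<open>Inserting 1 keeps the minimum defined when \<open>C\<close> is empty, which is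
    possible for negative \<open>B\<close>.\<close>
  define m where "m = Min (insert 1 (\<rho> ` C))"
  have m: "m > 0" "\<And>c. c \<in> C \<Longrightarrow> m \<le> \<rho> c"
  proof -
    have "\<forall>c\<in>C. \<rho> c > 0" using C(1) \<rho> by blast
    then show "m > 0" "\<And>c. c \<in> C \<Longrightarrow> m \<le> \<rho> c" using C(2) by (auto simp: m_def)
  qed
  show ?thesis
  proof (rule that[OF m(1)])
    fix X :: "real ^ 'n" and r :: real
    assume r: "r > 0" "norm X \<le> B" "\<bar>r - norm X\<bar> < m"
    then obtain c where c: "c \<in> C" "\<bar>norm X - c\<bar> < \<rho> c"
      using subsetD[OF C(3), of "norm X"] by (auto simp: dist_real_def abs_minus_commute)
    then have "?P c (\<rho> c)" "m \<le> \<rho> c" using C(1) m \<rho>[of c] by blast+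
    then obtain r' where "r' > 0" "\<bar>r' - norm X\<bar> \<ge> \<rho> c"
        "ball_avg (two_shells \<delta> \<tau> \<Lambda>) X r + \<rho> c \<le> ball_avg (two_shells \<delta> \<tau> \<Lambda>) X r'"
      using r c by (metis less_le_trans)
    then show "\<exists>r'>0. \<bar>r' - norm X\<bar> \<ge> m \<and>
      ball_avg (two_shells \<delta> \<tau> \<Lambda>) X r + m \<le> ball_avg (two_shells \<delta> \<tau> \<Lambda>) X r'"
      using \<open>m \<le> \<rho> c\<close> by (intro exI[of _ r']) auto
  qed
qed

text \<open>
  A ball through the origin misses a definite part of the shell \<open>U\<^sub>\<delta>\<close> on the far side, which for
  distant \<open>X\<close> outweighs the larger volume of the ball containing both shells.
\<close>

lemma ball_avg_gap_far:
  assumes \<delta>: "0 < \<delta>" "\<delta> \<le> 1 / 16" and shell: "\<tau> > 0" "\<Lambda> > 1 + \<tau>"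
  obtains \<rho> B where "\<rho> > 0" "\<And>(X :: 'a::euclidean_space) r. r > 0 \<Longrightarrow> norm X \<ge> B \<Longrightarrow> \<bar>r - norm X\<bar> < \<rho> \<Longrightarrow>
    \<exists>r'>0. \<bar>r' - norm X\<bar> \<ge> \<rho> \<and>
      ball_avg (two_shells \<delta> \<tau> \<Lambda>) X r + \<rho> / r ^ DIM('a) \<le> ball_avg (two_shells \<delta> \<tau> \<Lambda>) X r'"
proof -
  let ?F = "two_shells \<delta> \<tau> \<Lambda> :: 'a \<Rightarrow> real"
  let ?n = "DIM('a)" and ?c = "unit_ball_vol (real DIM('a))"
  define S where "S = \<Lambda> + \<tau>"
  \<comment> \<open>Normalised total mass: a ball of radius \<open>r'\<close> containing both shells
    has average \<open>M / r' ^ n\<close>.\<close>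
  define M where "M = (LINT y|lebesgue. ?F y) / ?c"
  \<comment> \<open>The normalised volume of the ball of radius 1/8 that will be missed.\<close>
  define q where "q = (1 / 8 :: real) ^ ?n"
  \<comment> \<open>Large enough for the Bernoulli error \<open>M * n * (S + 1/2) / r'\<close> below
    to be at most \<open>q / 2\<close>.\<close>
  define B where "B = 1 + 2 * (M * real ?n * (S + 1/2)) / q"
  have c: "?c > 0" by simp
  then have c0: "?c \<noteq> 0" by linarith
  have q: "q > 0" "q \<le> 1" by (auto simp: q_def power_le_one)
  have S: "S > 1" using shell by (simp add: S_def)
  have M0: "M \<ge> 0" using c two_shells_nonneg[of \<delta> \<tau> \<Lambda>]
    unfolding M_def by (intro divide_nonneg_pos Bochner_Integration.integral_nonneg) auto
  have "M * real ?n * (S + 1/2) \<ge> 0" using M0 S by (intro mult_nonneg_nonneg) auto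
  then have B: "B \<ge> 1" using q unfolding B_def by simp
  show ?thesis
  proof (rule that[of "q / 2" B])
    fix X :: 'a and r :: real
    assume r: "r > 0" "norm X \<ge> B" "\<bar>r - norm X\<bar> < q / 2"
    define R where "R = norm X"
    have R: "R \<ge> B" "R > 0" "\<bar>r - R\<bar> < 1 / 2" using r B q by (auto simp: R_def)
    \<comment> \<open>A point of the first shell opposite to \<open>X\<close>. Its 1/8-neighbourhood
      stays in the shell and is at distance more than \<open>R + 5/8\<close> from \<open>X\<close>,
      so \<open>ball X r\<close> misses it.\<close>
    define z where "z = (- (3/4) / R) *\<^sub>R X"
    have z: "norm z = 3/4" using R by (simp add: z_def R_def[symmetric])
    have "X - z = (1 + 3/4 / R) *\<^sub>R X" by (simp add: z_def scaleR_left_distrib scaleR_left_diff_distrib)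
    then have "norm (X - z) = \<bar>1 + 3/4 / R\<bar> * R" by (simp add: R_def)
    moreover have "\<bar>1 + 3/4 / R\<bar> = 1 + 3/4 / R" using R by simp
    ultimately have Xz: "norm (X - z) = R + 3/4" using R by (simp add: distrib_right)
    have miss: "y \<notin> ball X r" "5/8 < norm y" "norm y < 7/8" if "y \<in> ball z (1/8)" for y
    proof -
      have yz: "norm (z - y) < 1/8" using that by (simp add: dist_norm)
      have "norm y \<le> norm z + norm (z - y)" "norm z \<le> norm y + norm (z - y)"
        "norm (X - z) \<le> norm (X - y) + norm (z - y)"
        using norm_triangle_ineq4[of z "z - y"] norm_triangle_ineq[of y "z - y"]
          norm_triangle_ineq4[of "X - y" "z - y"] by simp_all
      then have "5/8 < norm y" "norm y < 7/8" "norm (X - y) \<ge> r"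
        using yz z Xz R(3) by linarith+
      then show "y \<notin> ball X r" "5/8 < norm y" "norm y < 7/8"
        by (simp_all add: dist_norm)
    qed
    have ind: "integrable lebesgue (indicator (ball z (1/8)) :: 'a \<Rightarrow> real)"
      using lmeasurable_ball[of z "1/8"] by (auto simp: fmeasurable_def)
    have "ball_mass ?F X r + measure lebesgue (ball z (1/8)) \<le> (LINT y|lebesgue. ?F y)"
    proof -
      have "ball_mass ?F X r + measure lebesgue (ball z (1/8)) =
          (LINT y|lebesgue. indicator (ball X r) y * ?F y + indicator (ball z (1/8)) y)"
        unfolding ball_mass_def set_lebesgue_integral_def
        using ball_integrable[OF integrable_two_shells, of X r \<delta> \<tau> \<Lambda>]
        by (subst Bochner_Integration.integral_add[OF _ ind]) (auto simp: set_integrable_def)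
      also have "\<dots> \<le> (LINT y|lebesgue. ?F y)"
      proof (rule integral_mono)
        show "integrable lebesgue (\<lambda>y. indicator (ball X r) y * ?F y + indicator (ball z (1/8)) y)"
          using ball_integrable[OF integrable_two_shells, of X r \<delta> \<tau> \<Lambda>]
          by (intro Bochner_Integration.integrable_add ind) (auto simp: set_integrable_def)
        fix y
        show "indicator (ball X r) y * ?F y + indicator (ball z (1/8)) y \<le> ?F y"
          using miss[of y] two_shells_nonneg[of \<delta> \<tau> \<Lambda> y] \<delta>
          by (cases "y \<in> ball z (1/8)") (auto simp: indicator_def two_shells_def)
      qed (rule integrable_two_shells)
      finally show ?thesis .
    qed
    then have "ball_mass ?F X r \<le> ?c * (M - q)"
      using c0 by (simp add: M_def q_def content_ball right_diff_distrib)
    then have "ball_avg ?F X r \<le> ?c * (M - q) / (?c * r ^ ?n)"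
      unfolding ball_avg_def using r c by (intro divide_right_mono) auto
    then have up: "ball_avg ?F X r \<le> (M - q) / r ^ ?n" using c0 by simp
    \<comment> \<open>The radius of the smallest ball about \<open>X\<close> that contains both
      shells.\<close>
    define r' where "r' = R + S"
    have full: "ball_mass ?F X r' = (LINT y|lebesgue. ?F y)"
      unfolding ball_mass_def set_lebesgue_integral_def
    proof (rule Bochner_Integration.integral_cong)
      fix y
      show "indicator (ball X r') y *\<^sub>R ?F y = ?F y"
      proof (cases "norm y < S")
        case True
        then have "y \<in> ball X r'" using norm_triangle_ineq4[of X y] by (simp add: r'_def dist_norm R_def)
        then show ?thesis by simp
      qed (use S shell in \<open>auto simp: two_shells_def S_def\<close>)
    qed simp
    have low: "ball_avg ?F X r' = M / r' ^ ?n" using c0 by (simp add: ball_avg_def full M_def)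
    \<comment> \<open>By Bernoulli, \<open>(r / r') ^ n\<close> is at least
      \<open>1 - n * (S + 1/2) / r'\<close>. The loss from enlarging the ball is thus at most half
      of the missed mass.\<close>
    have "M - q + q / 2 \<le> M * (1 + real ?n * (- (S + 1/2) / r'))"
    proof -
      have "M * real ?n * (S + 1/2) / r' \<le> M * real ?n * (S + 1/2) / B"
        using R B S M0 by (intro divide_left_mono mult_nonneg_nonneg) (auto simp: r'_def)
      also have "\<dots> \<le> q / 2"
      proof -
        have "q / 2 * (1 + 2 * K / q) = q / 2 + K" for K using q by (simp add: field_simps)
        then have "q / 2 * B = q / 2 + M * real ?n * (S + 1/2)" unfolding B_def .
        then have "M * real ?n * (S + 1/2) \<le> q / 2 * B" using q by linarith
        then show ?thesis using B by (simp add: pos_divide_le_eq)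
      qed
      finally have "M * real ?n * (S + 1/2) / r' \<le> q / 2" .
      moreover have "M * (1 + N * (- T / r')) = M - M * N * T / r'" for N T
        by (simp add: right_diff_distrib)
      ultimately show ?thesis by (simp only:)
    qed
    also have "\<dots> \<le> M * (1 + (- (S + 1/2) / r')) ^ ?n"
    proof (intro mult_left_mono Bernoulli_inequality)
      have "(S + 1/2) / r' \<le> 1" using R B S by (simp add: r'_def)
      then show "- 1 \<le> - (S + 1/2) / r'" unfolding minus_divide_left[symmetric] by linarith
    qed (rule M0)
    also have "1 + (- (S + 1/2) / r') = (R - 1/2) / r'"
    proof -
      have "R - 1/2 = r' + - (S + 1/2)" "r' \<noteq> 0" using R S by (auto simp: r'_def)
      then show ?thesis by (metis add_divide_distrib divide_self)
    qed
    also have "M * ((R - 1/2) / r') ^ ?n \<le> M * (r / r') ^ ?n"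
    proof -
      have "R - 1/2 \<le> r" using R(3) by linarith
      then show ?thesis
        using M0 R B S by (intro mult_left_mono power_mono divide_right_mono) (auto simp: r'_def)
    qed
    finally have "(M - q + q / 2) / r ^ ?n \<le> M * (r / r') ^ ?n / r ^ ?n"
      using r by (intro divide_right_mono) auto
    also have "\<dots> = M / r' ^ ?n" using r by (simp add: power_divide)
    finally have "ball_avg ?F X r + q / 2 / r ^ ?n \<le> ball_avg ?F X r'"
      using up unfolding low add_divide_distrib by linarith
    moreover have "\<bar>r' - norm X\<bar> \<ge> q / 2" "r' > 0" using S q R(2) by (simp_all add: r'_def R_def[symmetric])
    ultimately show "\<exists>r'>0. \<bar>r' - norm X\<bar> \<ge> q / 2 \<and> ball_avg ?F X r + q / 2 / r ^ ?n \<le> ball_avg ?F X r'"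
      by blast
  qed (use q in auto)
qed

text \<open>The weight \<open>min 1 (1 / r ^ n)\<close> covers the constant gap for bounded
  \<open>X\<close> and the decaying gap for distant \<open>X\<close>; averages of the perturbation
  obey a bound of the same form.\<close>

lemma ball_avg_gap:
  assumes card: "CARD('n::finite) \<ge> 2"
    and \<delta>: "0 < \<delta>" "\<delta> \<le> 1 / 16" and shell: "\<tau> > 0" "\<Lambda> > 1 + \<tau>"
    and improve: "\<And>R. R > 0 \<Longrightarrow> \<exists>r'>0. r' \<noteq> R \<and>
      shells_avg CARD('n) \<delta> \<tau> \<Lambda> R R < shells_avg CARD('n) \<delta> \<tau> \<Lambda> R r'"
  obtains \<rho> where "\<rho> > 0" "\<And>(X :: real ^ 'n) r. r > 0 \<Longrightarrow> \<bar>r - norm X\<bar> < \<rho> \<Longrightarrow>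
    \<exists>r'>0. \<bar>r' - norm X\<bar> \<ge> \<rho> \<and>
      ball_avg (two_shells \<delta> \<tau> \<Lambda>) X r + \<rho> * min 1 (1 / r ^ CARD('n)) \<le> ball_avg (two_shells \<delta> \<tau> \<Lambda>) X r'"
proof -
  let ?A = "ball_avg (two_shells \<delta> \<tau> \<Lambda> :: real ^ 'n \<Rightarrow> real)"
  obtain \<rho>1 B where 1: "\<rho>1 > 0" "\<And>(X :: real ^ 'n) r. r > 0 \<Longrightarrow> norm X \<ge> B \<Longrightarrow> \<bar>r - norm X\<bar> < \<rho>1 \<Longrightarrow>
    \<exists>r'>0. \<bar>r' - norm X\<bar> \<ge> \<rho>1 \<and> ?A X r + \<rho>1 / r ^ CARD('n) \<le> ?A X r'"
    by (rule ball_avg_gap_far[OF \<delta> shell, where 'a="real ^ 'n", unfolded DIM_cart DIM_real mult_1_right]) (rule that)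
  obtain \<rho>2 where 2: "\<rho>2 > 0" "\<And>(X :: real ^ 'n) r. r > 0 \<Longrightarrow> norm X \<le> B \<Longrightarrow> \<bar>r - norm X\<bar> < \<rho>2 \<Longrightarrow>
    \<exists>r'>0. \<bar>r' - norm X\<bar> \<ge> \<rho>2 \<and> ?A X r + \<rho>2 \<le> ?A X r'"
    by (rule ball_avg_gap_bounded[where B=B, OF card \<delta> shell]) (erule improve, rule that)
  show ?thesis
  proof (rule that[of "min \<rho>1 \<rho>2"])
    fix X :: "real ^ 'n" and r :: real
    assume r: "r > 0" "\<bar>r - norm X\<bar> < min \<rho>1 \<rho>2"
    have le1: "min \<rho>1 \<rho>2 * min 1 (1 / r ^ CARD('n)) \<le> \<rho>1 * (1 / r ^ CARD('n))"
      using 1 r by (intro mult_mono) auto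
    have le2: "min \<rho>1 \<rho>2 * min 1 (1 / r ^ CARD('n)) \<le> \<rho>2 * 1"
      using 2 r by (intro mult_mono) auto
    show "\<exists>r'>0. \<bar>r' - norm X\<bar> \<ge> min \<rho>1 \<rho>2 \<and> ?A X r + min \<rho>1 \<rho>2 * min 1 (1 / r ^ CARD('n)) \<le> ?A X r'"
    proof (cases "norm X \<ge> B")
      case True
      then obtain r' where "r' > 0" "\<bar>r' - norm X\<bar> \<ge> \<rho>1" "?A X r + \<rho>1 / r ^ CARD('n) \<le> ?A X r'"
        using 1(2)[of r X] r by auto
      then show ?thesis using le1 by (intro exI[of _ r']) auto
    next
      case False
      then obtain r' where "r' > 0" "\<bar>r' - norm X\<bar> \<ge> \<rho>2" "?A X r + \<rho>2 \<le> ?A X r'"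
        using 2(2)[of r X] r by auto
      then show ?thesis using le2 by (intro exI[of _ r']) auto
    qed
  qed (use 1 2 in auto)
qed

section \<open>The perturbation\<close>

text \<open>Comparison with the series of \<open>exp (- k)\<close> times the indicator of the ball
  of radius \<open>k + 1\<close>, which converges because exponentials beat powers.\<close>

lemma integrable_exp_neg_norm:
  "integrable lebesgue (\<lambda>y :: 'a::euclidean_space. exp (- norm y))"
proof (rule integrableI_nonneg)
  let ?n = "DIM('a)" and ?c = "unit_ball_vol (real DIM('a))"
  have meas: "(\<lambda>y :: 'a. exp (- norm y)) \<in> borel_measurable borel"
    by (intro borel_measurable_continuous_onI continuous_intros)
  then show "(\<lambda>y :: 'a. exp (- norm y)) \<in> borel_measurable lebesgue"
    by (simp add: measurable_completion)
  define a where "a k = exp (- real k) * (?c * (real k + 1) ^ ?n)" for k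
  have a_nonneg: "a k \<ge> 0" for k by (simp add: a_def)
  have "summable a"
  proof (rule summable_comparison_test')
    show "summable (\<lambda>k. ?c * (2 * real ?n) ^ ?n * exp (- 1 / 2) ^ k)"
      by (intro summable_mult summable_geometric) simp
    fix k :: nat
    \<comment> \<open>Arranged so that \<open>(1 + x / n) ^ n \<le> exp x\<close> applies with
      \<open>x = k / 2\<close>, spending half of the exponential decay.\<close>
    have "(real k + 1) ^ ?n \<le> (2 * real ?n * (1 + (real k / 2) / real ?n)) ^ ?n"
    proof (rule power_mono)
      have n: "real ?n \<ge> 1" using DIM_ge_Suc0[where 'a='a] by simp
      then have eq: "2 * real ?n * (1 + (real k / 2) / real ?n) = 2 * real ?n + real k"
        by (simp add: field_simps)
      show "real k + 1 \<le> 2 * real ?n * (1 + (real k / 2) / real ?n)"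
        unfolding eq using n by linarith
    qed simp
    also have "\<dots> = (2 * real ?n) ^ ?n * (1 + (real k / 2) / real ?n) ^ ?n"
      by (simp add: power_mult_distrib)
    also have "\<dots> \<le> (2 * real ?n) ^ ?n * exp (real k / 2)"
      by (intro mult_left_mono exp_ge_one_plus_x_over_n_power_n) auto
    finally have "exp (- real k) * (?c * (real k + 1) ^ ?n) \<le> exp (- real k) * (?c * ((2 * real ?n) ^ ?n * exp (real k / 2)))"
      by (intro mult_left_mono) auto
    also have "\<dots> = ?c * (2 * real ?n) ^ ?n * (exp (- real k) * exp (real k / 2))" by simp
    also have "exp (- real k) * exp (real k / 2) = exp (- 1 / 2) ^ k"
      by (simp add: exp_add[symmetric] exp_of_nat_mult[symmetric])
    finally show "norm (a k) \<le> ?c * (2 * real ?n) ^ ?n * exp (- 1 / 2) ^ k"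
      using a_nonneg by (simp add: a_def)
  qed
  have "(\<integral>\<^sup>+(y :: 'a). ennreal (exp (- norm y)) \<partial>lebesgue)
      \<le> (\<integral>\<^sup>+(y :: 'a). (\<Sum>k. ennreal (exp (- real k)) * indicator (ball 0 (real k + 1)) y) \<partial>lebesgue)"
  proof (rule nn_integral_mono)
    fix y :: 'a
    define k where "k = nat \<lfloor>norm y\<rfloor>"
    have k: "real k \<le> norm y" "norm y < real k + 1"
      unfolding k_def by (auto simp: of_nat_nat)
    have "ennreal (exp (- norm y)) \<le> ennreal (exp (- real k)) * indicator (ball 0 (real k + 1)) y"
      using k by (simp add: ennreal_leI)
    also have "\<dots> \<le> (\<Sum>k. ennreal (exp (- real k)) * indicator (ball 0 (real k + 1)) y)"
    proof -
      have "h k \<le> (\<Sum>k. h k)" for h :: "nat \<Rightarrow> ennreal"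
        using sum_le_suminf[of h "{k}"] by simp
      then show ?thesis .
    qed
    finally show "ennreal (exp (- norm y)) \<le> (\<Sum>k. ennreal (exp (- real k)) * indicator (ball 0 (real k + 1)) y)" .
  qed
  also have "\<dots> = (\<Sum>k. \<integral>\<^sup>+(y :: 'a). ennreal (exp (- real k)) * indicator (ball 0 (real k + 1)) y \<partial>lebesgue)"
    by (intro nn_integral_suminf borel_measurable_times_ennreal borel_measurable_const
        borel_measurable_indicator) simp
  also have "\<dots> = (\<Sum>k. ennreal (a k))"
    by (simp add: nn_integral_cmult_indicator emeasure_ball a_def ennreal_mult)
  also have "\<dots> = ennreal (\<Sum>k. a k)"
    using a_nonneg \<open>summable a\<close> by (intro suminf_ennreal2) auto
  also have "\<dots> < \<infinity>" by simp
  finally show "(\<integral>\<^sup>+(y :: 'a). ennreal (exp (- norm y)) \<partial>lebesgue) < \<infinity>" .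
qed auto

section \<open>The bump of mean zero\<close>

lemma two_pow_DIM_ge: "(2 :: real) ^ DIM('a::euclidean_space) \<ge> 2"
  using power_increasing[of 1 "DIM('a)" "2 :: real"] DIM_positive[where 'a='a] by simp

lemma abs_bump_le:
  "\<bar>bump \<eta> (y :: 'a::euclidean_space)\<bar> \<le> 1 / 2"
proof -
  have "1 / (2 * (2 ^ DIM('a) - 1)) \<le> (1 / 2 :: real)" "1 / (2 * (2 ^ DIM('a) - 1)) \<ge> (0 :: real)"
    using two_pow_DIM_ge[where 'a='a] by (auto simp: divide_simps)
  then show ?thesis unfolding bump_def by (auto simp: indicator_def)
qed

lemma bump_eq_0: "\<eta> > 0 \<Longrightarrow> y \<notin> ball 0 \<eta> \<Longrightarrow> bump \<eta> y = 0"
  by (auto simp: bump_def indicator_def)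

lemma integrable_indicator_fmeasurable: "A \<in> fmeasurable M \<Longrightarrow> integrable M (indicator A :: 'a \<Rightarrow> real)"
  by (auto simp: fmeasurable_def)

lemma integrable_bump: "integrable lebesgue (bump \<eta> :: 'a::euclidean_space \<Rightarrow> real)"
  unfolding bump_def[abs_def]
  by (intro Bochner_Integration.integrable_diff integrable_mult_right integrable_indicator_fmeasurable fmeasurable.Diff) auto

lemma measure_half_annulus:
  assumes "\<eta> > 0"
  shows "measure lebesgue (ball 0 \<eta> - ball (0 :: 'a::euclidean_space) (\<eta> / 2))
    = unit_ball_vol (real DIM('a)) * (\<eta> / 2) ^ DIM('a) * (2 ^ DIM('a) - 1)"
proof -
  have "measure lebesgue (ball 0 \<eta> - ball (0 :: 'a) (\<eta> / 2))
      = measure lebesgue (ball (0 :: 'a) \<eta>) - measure lebesgue (ball (0 :: 'a) (\<eta> / 2))"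
    using assms by (intro measurable_measure_Diff) auto
  then show ?thesis using assms by (simp add: content_ball field_simps power_divide)
qed

text \<open>The annulus has \<open>2 ^ n - 1\<close> times the volume of the inner ball, which the
  two coefficients balance.\<close>

lemma integral_bump:
  assumes "\<eta> > 0" shows "(LINT y|lebesgue. bump \<eta> (y :: 'a::euclidean_space)) = 0"
proof -
  have ind: "integrable lebesgue (indicator (ball (0 :: 'a) (\<eta> / 2)) :: 'a \<Rightarrow> real)"
      "integrable lebesgue (indicator (ball (0 :: 'a) \<eta> - ball 0 (\<eta> / 2)) :: 'a \<Rightarrow> real)"
    by (auto intro!: integrable_indicator_fmeasurable fmeasurable.Diff)
  have "(LINT y|lebesgue. bump \<eta> (y :: 'a)) = 1 / 2 * measure lebesgue (ball (0 :: 'a) (\<eta> / 2))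
      - 1 / (2 * (2 ^ DIM('a) - 1)) * measure lebesgue (ball 0 \<eta> - ball (0 :: 'a) (\<eta> / 2))"
    unfolding bump_def[abs_def] using ind
    by (subst Bochner_Integration.integral_diff) (simp_all del: measure_completion)
  also have "measure lebesgue (ball (0 :: 'a) (\<eta> / 2)) = unit_ball_vol (real DIM('a)) * (\<eta> / 2) ^ DIM('a)"
    using assms by (simp add: content_ball)
  also note measure_half_annulus[OF assms]
  also have "1 / 2 * x - 1 / (2 * (T - 1)) * (x * (T - 1)) = 0" if "T \<ge> 2" for x T :: real
    using that by (simp add: field_simps)
  note this[OF two_pow_DIM_ge]
  finally show ?thesis .
qed

text \<open>The absolute value is the indicator of the inner ball minus the bump, and the bump has
  integral zero.\<close>

lemma integral_abs_bump:
  assumes "\<eta> > 0"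
  shows "(LINT y|lebesgue. \<bar>bump \<eta> (y :: 'a::euclidean_space)\<bar>) = unit_ball_vol (real DIM('a)) * (\<eta> / 2) ^ DIM('a)"
proof -
  have ind: "integrable lebesgue (indicator (ball (0 :: 'a) (\<eta> / 2)) :: 'a \<Rightarrow> real)"
    by (auto intro!: integrable_indicator_fmeasurable)
  have "\<bar>bump \<eta> (y :: 'a)\<bar> = indicator (ball 0 (\<eta> / 2)) y - bump \<eta> y" for y
    using two_pow_DIM_ge[where 'a='a] by (auto simp: bump_def indicator_def)
  then have "(LINT y|lebesgue. \<bar>bump \<eta> (y :: 'a)\<bar>) = measure lebesgue (ball (0 :: 'a) (\<eta> / 2))"
    using ind integrable_bump[of \<eta>, where 'a='a] integral_bump[OF assms, where 'a='a]
    by (simp add: Bochner_Integration.integral_diff del: measure_completion)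
  then show ?thesis using assms by (simp add: content_ball)
qed

text \<open>Such a ball contains the support of the bump or is disjoint from it.\<close>

lemma ball_mass_bump:
  assumes "\<eta> > 0" "\<bar>r - norm X\<bar> \<ge> \<eta>"
  shows "ball_mass (bump \<eta>) (X :: 'a::euclidean_space) r = 0"
proof (cases "r \<ge> norm X + \<eta>")
  case True
  have "indicator (ball X r) y *\<^sub>R bump \<eta> y = bump \<eta> y" for y
  proof (cases "y \<in> ball 0 \<eta>")
    case y: True
    then have "y \<in> ball X r" using True norm_triangle_ineq4[of X y] by (simp add: dist_norm)
    then show ?thesis by simp
  qed (use assms bump_eq_0 in auto)
  then show ?thesis
    unfolding ball_mass_def set_lebesgue_integral_def by (simp only: integral_bump[OF assms(1)])
next
  case False
  then have r: "r \<le> norm X - \<eta>" using assms by linarith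
  have "indicator (ball X r) y *\<^sub>R bump \<eta> y = 0" for y
  proof (cases "y \<in> ball 0 \<eta>")
    case True
    then have "y \<notin> ball X r" using r norm_triangle_sub[of X y] by (simp add: dist_norm)
    then show ?thesis by simp
  qed (use assms bump_eq_0 in auto)
  then show ?thesis
    unfolding ball_mass_def set_lebesgue_integral_def by (simp only: Bochner_Integration.integral_zero)
qed

section \<open>Maximal functions of the perturbed shells\<close>

lemma central_maximal_eq_SUP_ball_avg:
  fixes \<phi> :: "'a::euclidean_space \<Rightarrow> real"
  assumes "integrable lebesgue \<phi>" "\<And>y. \<phi> y \<ge> 0"
  shows "central_maximal \<phi> X = (SUP r\<in>{0<..}. ennreal (ball_avg \<phi> X r))"
  unfolding central_maximal_def
proof (rule SUP_cong)
  fix r :: real assume "r \<in> {0<..}"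
  then have r: "r > 0" by simp
  have "(\<integral>\<^sup>+ t\<in>ball X r. ennreal \<bar>\<phi> t\<bar> \<partial>lebesgue) = (\<integral>\<^sup>+ t. ennreal (indicator (ball X r) t *\<^sub>R \<phi> t) \<partial>lebesgue)"
    using assms(2) by (intro nn_integral_cong) (auto simp: indicator_def)
  also have "\<dots> = ennreal (ball_mass \<phi> X r)"
    unfolding ball_mass_def set_lebesgue_integral_def
    using ball_integrable[OF assms(1), of X r] assms(2)
    by (intro nn_integral_eq_integral) (auto simp: set_integrable_def)
  finally have "(\<integral>\<^sup>+ t\<in>ball X r. ennreal \<bar>\<phi> t\<bar> \<partial>lebesgue) / emeasure lebesgue (ball X r)
     = ennreal (ball_mass \<phi> X r) / ennreal (unit_ball_vol (real DIM('a)) * r ^ DIM('a))"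
    using r by (simp add: emeasure_ball)
  also have "\<dots> = ennreal (ball_avg \<phi> X r)"
    unfolding ball_avg_def using r assms(2)
    by (intro divide_ennreal) (auto simp: ball_mass_def set_lebesgue_integral_def intro!: Bochner_Integration.integral_nonneg)
  finally show "(\<integral>\<^sup>+ t\<in>ball X r. ennreal \<bar>\<phi> t\<bar> \<partial>lebesgue) / emeasure lebesgue (ball X r) = ennreal (ball_avg \<phi> X r)" .
qed simp

text \<open>One family for both functions: \<open>s = 1\<close> gives f and \<open>s = - 1\<close>
  gives g.\<close>

definition perturbed :: "real \<Rightarrow> real \<Rightarrow> real \<Rightarrow> real \<Rightarrow> real \<Rightarrow> real \<Rightarrow> 'a::euclidean_space \<Rightarrow> real"
  where "perturbed \<delta> \<tau> \<Lambda> \<eta> \<epsilon> s y = two_shells \<delta> \<tau> \<Lambda> y + \<epsilon> * (exp (- norm y) + s * bump \<eta> y)"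

lemma integrable_perturbed: "integrable lebesgue (perturbed \<delta> \<tau> \<Lambda> \<eta> \<epsilon> s :: 'a::euclidean_space \<Rightarrow> real)"
  unfolding perturbed_def[abs_def]
  by (intro Bochner_Integration.integrable_add integrable_mult_right integrable_two_shells
      integrable_exp_neg_norm integrable_bump)

lemma ball_mass_mult: "ball_mass (\<lambda>y. c * \<phi> y) X r = c * ball_mass \<phi> X r"
  by (simp add: ball_mass_def)

lemma ball_mass_perturbed:
  "ball_mass (perturbed \<delta> \<tau> \<Lambda> \<eta> \<epsilon> s) X r = ball_mass (two_shells \<delta> \<tau> \<Lambda>) X r
    + \<epsilon> * (ball_mass (\<lambda>y. exp (- norm y)) X r + s * ball_mass (bump \<eta>) X (r :: real))"
  for X :: "'a::euclidean_space"
  unfolding perturbed_def[abs_def]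
  by (simp add: ball_mass_add ball_mass_mult integrable_two_shells integrable_exp_neg_norm integrable_bump)

lemma exp_neg_norm_gt_half:
  assumes "\<eta> \<le> 1 / 16" "norm y < \<eta>" shows "exp (- norm y) > 1 / 2"
proof -
  have "1 + - norm y \<le> exp (- norm y)" by (rule exp_ge_add_one_self)
  then show ?thesis using assms by linarith
qed

text \<open>On the ball of radius \<eta> the exponential exceeds 1/2, which bounds the bump.\<close>

lemma exp_plus_bump_pos:
  assumes "0 < \<eta>" "\<eta> \<le> 1 / 16" "\<bar>s\<bar> \<le> 1"
  shows "exp (- norm y) + s * bump \<eta> y > 0"
proof (cases "y \<in> ball 0 \<eta>")
  case True
  have "\<bar>s * bump \<eta> y\<bar> \<le> 1 * (1 / 2)"
    unfolding abs_mult using assms abs_bump_le by (intro mult_mono) auto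
  then show ?thesis using exp_neg_norm_gt_half[OF assms(2), of y] True by auto
qed (use assms bump_eq_0[of \<eta> y] in auto)

lemma perturbed_pos:
  assumes "0 < \<eta>" "\<eta> \<le> 1 / 16" "\<bar>s\<bar> \<le> 1" "\<epsilon> > 0"
  shows "perturbed \<delta> \<tau> \<Lambda> \<eta> \<epsilon> s y > 0"
  using exp_plus_bump_pos[OF assms(1-3), of y] two_shells_nonneg[of \<delta> \<tau> \<Lambda> y] assms(4)
  by (simp add: perturbed_def add_nonneg_pos)

text \<open>The perturbation lies below \<open>2 * exp (- norm y)\<close>. This function is bounded
  by 2 and integrable, which gives the two parts of the minimum with a constant independent of
  \<open>X\<close>, \<open>s\<close> and \<eta>.\<close>

lemma ball_avg_perturbation_le:
  obtains C where "C > 0" "\<And>X r s \<eta>. r > 0 \<Longrightarrow> \<bar>s\<bar> \<le> 1 \<Longrightarrow> 0 < \<eta> \<Longrightarrow> \<eta> \<le> 1 / 16 \<Longrightarrow>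
    ball_avg (\<lambda>y :: 'a::euclidean_space. exp (- norm y) + s * bump \<eta> y) X r \<le> C * min 1 (1 / r ^ DIM('a))"
proof -
  let ?n = "DIM('a)" and ?c = "unit_ball_vol (real DIM('a))"
  have c: "?c > 0" by simp
  have c0: "?c \<noteq> 0" using c by linarith
  define I where "I = (LINT y|lebesgue. 2 * exp (- norm (y :: 'a)))"
  have I: "I \<ge> 0" unfolding I_def by (intro Bochner_Integration.integral_nonneg) auto
  define C where "C = max 2 (I / ?c)"
  show ?thesis
  proof (rule that[of C])
    fix X :: 'a and r s \<eta> :: real
    assume r: "r > 0" and s: "\<bar>s\<bar> \<le> 1" and \<eta>: "0 < \<eta>" "\<eta> \<le> 1 / 16"
    let ?g = "\<lambda>y :: 'a. exp (- norm y) + s * bump \<eta> y"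
    have int: "integrable lebesgue ?g" "integrable lebesgue (\<lambda>y :: 'a. 2 * exp (- norm y))"
      by (intro Bochner_Integration.integrable_add integrable_mult_right
        integrable_exp_neg_norm integrable_bump)+
    have le: "?g y \<le> 2 * exp (- norm y)" for y
    proof -
      \<comment> \<open>Positivity for the opposite sign \<open>- s\<close> says that
        \<open>s * bump \<eta> y\<close> is below the exponential.\<close>
      have "exp (- norm y) + (- s) * bump \<eta> y > 0" using exp_plus_bump_pos[OF \<eta>, of "- s" y] s by simp
      then show ?thesis by simp
    qed
    have "ball_mass ?g X r \<le> I"
      unfolding ball_mass_def set_lebesgue_integral_def I_def
    proof (rule integral_mono)
      show "integrable lebesgue (\<lambda>y. indicator (ball X r) y *\<^sub>R ?g y)"
        using ball_integrable[OF int(1), of X r] by (simp add: set_integrable_def)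
      show "indicator (ball X r) y *\<^sub>R ?g y \<le> 2 * exp (- norm y)" for y
        using le[of y] by (simp add: indicator_def)
    qed (rule int)
    then have "ball_avg ?g X r \<le> I / (?c * r ^ ?n)"
      unfolding ball_avg_def using r c by (intro divide_right_mono) auto
    also have "\<dots> = I / ?c * (1 / r ^ ?n)" by simp
    also have "\<dots> \<le> C * (1 / r ^ ?n)" unfolding C_def using r by (intro mult_right_mono) auto
    finally have 1: "ball_avg ?g X r \<le> C * (1 / r ^ ?n)" .
    have "ball_mass ?g X r \<le> ball_mass (\<lambda>y. 2 * indicator (ball X r) y) X r"
      unfolding ball_mass_def
    proof (intro set_integral_mono ball_integrable int)
      show "integrable lebesgue (\<lambda>y. 2 * indicator (ball X r) y :: real)"
        by (intro integrable_mult_right integrable_indicator_fmeasurable) auto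
      fix y assume "y \<in> ball X r"
      have "exp (- norm y) \<le> 1" by simp
      then have "?g y \<le> 2" using le[of y] by linarith
      then show "?g y \<le> 2 * indicator (ball X r) y" using \<open>y \<in> ball X r\<close> by simp
    qed
    also have "\<dots> = 2 * (?c * r ^ ?n)"
      using r by (simp add: ball_mass_mult ball_mass_indicator content_ball)
    finally have "ball_avg ?g X r \<le> 2 * (?c * r ^ ?n) / (?c * r ^ ?n)"
      unfolding ball_avg_def using r c by (intro divide_right_mono) auto
    then have "ball_avg ?g X r \<le> C" using r c0 by (simp add: C_def)
    with 1 show "ball_avg ?g X r \<le> C * min 1 (1 / r ^ ?n)" by (simp add: min_def)
  qed (simp add: C_def)
qed

lemma ball_avg_perturbed:
  "ball_avg (perturbed \<delta> \<tau> \<Lambda> \<eta> \<epsilon> s) X r = ball_avg (two_shells \<delta> \<tau> \<Lambda>) X r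
    + \<epsilon> * ball_avg (\<lambda>y. exp (- norm y) + s * bump \<eta> y) X r"
  for X :: "'a::euclidean_space"
  unfolding ball_avg_def perturbed_def[abs_def]
  by (simp add: ball_mass_add ball_mass_mult integrable_two_shells integrable_exp_neg_norm integrable_bump
      add_divide_distrib distrib_left)

text \<open>The bump drops out, so the average is the same for every \<open>s\<close>.\<close>

lemma ball_avg_perturbed_good:
  assumes "\<eta> > 0" "\<bar>r - norm X\<bar> \<ge> \<eta>"
  shows "ball_avg (perturbed \<delta> \<tau> \<Lambda> \<eta> \<epsilon> s) (X :: 'a::euclidean_space) r =
    ball_avg (two_shells \<delta> \<tau> \<Lambda>) X r + \<epsilon> * ball_avg (\<lambda>y. exp (- norm y)) X r"
  using ball_mass_bump[OF assms]
  by (simp add: ball_avg_def ball_mass_perturbed add_divide_distrib)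

text \<open>Each radius for \<open>s\<close> is matched by one for \<open>t\<close>: itself if the
  bump does not affect it, otherwise the far radius supplied by \<open>gap\<close>, whose surplus
  dominates the perturbation. Exchanging \<open>s\<close> and \<open>t\<close> gives
  equality.\<close>

lemma central_maximal_perturbed_le:
  fixes X :: "real ^ 'n"
  assumes gap: "\<And>(X :: real ^ 'n) r. r > 0 \<Longrightarrow> \<bar>r - norm X\<bar> < \<rho> \<Longrightarrow>
    \<exists>r'>0. \<bar>r' - norm X\<bar> \<ge> \<rho> \<and>
      ball_avg (two_shells \<delta> \<tau> \<Lambda>) X r + \<rho> * min 1 (1 / r ^ CARD('n)) \<le> ball_avg (two_shells \<delta> \<tau> \<Lambda>) X r'"
    and C: "\<And>(X :: real ^ 'n) r s \<eta>. r > 0 \<Longrightarrow> \<bar>s\<bar> \<le> 1 \<Longrightarrow> 0 < \<eta> \<Longrightarrow> \<eta> \<le> 1 / 16 \<Longrightarrow>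
      ball_avg (\<lambda>y. exp (- norm y) + s * bump \<eta> y) X r \<le> C * min 1 (1 / r ^ CARD('n))"
    and \<eta>: "0 < \<eta>" "\<eta> \<le> 1 / 16" "\<eta> \<le> \<rho>" and \<epsilon>: "0 < \<epsilon>" "\<epsilon> * C \<le> \<rho>"
    and s: "\<bar>s\<bar> \<le> 1" and t: "\<bar>t\<bar> \<le> 1"
  shows "central_maximal (perturbed \<delta> \<tau> \<Lambda> \<eta> \<epsilon> s) X \<le> central_maximal (perturbed \<delta> \<tau> \<Lambda> \<eta> \<epsilon> t) X"
proof -
  let ?f = "perturbed \<delta> \<tau> \<Lambda> \<eta> \<epsilon> :: real \<Rightarrow> real ^ 'n \<Rightarrow> real"
  let ?A = "ball_avg (two_shells \<delta> \<tau> \<Lambda>) X"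
  have eq: "central_maximal (?f u) X = (SUP r\<in>{0<..}. ennreal (ball_avg (?f u) X r))" if "\<bar>u\<bar> \<le> 1" for u
    by (intro central_maximal_eq_SUP_ball_avg integrable_perturbed
      less_imp_le[OF perturbed_pos[OF \<eta>(1,2) that \<epsilon>(1)]])
  have exp_nonneg: "ball_avg (\<lambda>y. exp (- norm y)) X r \<ge> 0" if "r > 0" for r
    unfolding ball_avg_def ball_mass_def set_lebesgue_integral_def using that
    by (intro divide_nonneg_nonneg Bochner_Integration.integral_nonneg) auto
  have "\<exists>r'\<in>{0<..}. ennreal (ball_avg (?f s) X r) \<le> ennreal (ball_avg (?f t) X r')" if r: "r \<in> {0<..}" for r
  proof (cases "\<bar>r - norm X\<bar> \<ge> \<eta>")
    case True
    then show ?thesis using r \<eta> by (intro bexI[of _ r]) (auto simp: ball_avg_perturbed_good)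
  next
    case False
    then obtain r' where r': "r' > 0" "\<bar>r' - norm X\<bar> \<ge> \<rho>" "?A r + \<rho> * min 1 (1 / r ^ CARD('n)) \<le> ?A r'"
      using gap[of r X] r \<eta> by auto
    have "ball_avg (?f s) X r \<le> ?A r + \<epsilon> * (C * min 1 (1 / r ^ CARD('n)))"
      unfolding ball_avg_perturbed using r s \<eta> \<epsilon> by (intro add_left_mono mult_left_mono C) auto
    also have "\<epsilon> * (C * min 1 (1 / r ^ CARD('n))) \<le> \<rho> * min 1 (1 / r ^ CARD('n))"
      unfolding mult.assoc[symmetric] using r \<epsilon> by (intro mult_right_mono) auto
    also have "?A r + \<rho> * min 1 (1 / r ^ CARD('n)) \<le> ?A r'" by (rule r')
    also have "?A r' \<le> ball_avg (?f t) X r'"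
      using ball_avg_perturbed_good[of \<eta> r' X \<delta> \<tau> \<Lambda> \<epsilon> t] \<eta> r' \<epsilon> exp_nonneg[OF r'(1)] by simp
    finally show ?thesis using r' by (intro bexI[of _ r']) (auto intro: ennreal_leI)
  qed
  then show ?thesis unfolding eq[OF s] eq[OF t] by (rule SUP_mono)
qed

lemma bounded_perturbed: "bounded (range (perturbed \<delta> \<tau> \<Lambda> \<eta> \<epsilon> s :: 'a::euclidean_space \<Rightarrow> real))"
proof (rule boundedI)
  fix z assume "z \<in> range (perturbed \<delta> \<tau> \<Lambda> \<eta> \<epsilon> s :: 'a \<Rightarrow> real)"
  then obtain y :: 'a where z: "z = perturbed \<delta> \<tau> \<Lambda> \<eta> \<epsilon> s y" by blast
  have "\<bar>s * bump \<eta> y\<bar> \<le> \<bar>s\<bar> * (1 / 2)" unfolding abs_mult using abs_bump_le by (intro mult_left_mono) auto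
  moreover have "\<bar>exp (- norm y)\<bar> \<le> 1" by simp
  ultimately have "\<bar>exp (- norm y) + s * bump \<eta> y\<bar> \<le> 1 + \<bar>s\<bar> / 2"
    using abs_triangle_ineq[of "exp (- norm y)" "s * bump \<eta> y"] by linarith
  then have "\<bar>\<epsilon> * (exp (- norm y) + s * bump \<eta> y)\<bar> \<le> \<bar>\<epsilon>\<bar> * (1 + \<bar>s\<bar> / 2)"
    unfolding abs_mult by (intro mult_left_mono) auto
  moreover have "\<bar>two_shells \<delta> \<tau> \<Lambda> y\<bar> \<le> 2" by (simp add: two_shells_def indicator_def)
  ultimately show "norm z \<le> 2 + \<bar>\<epsilon>\<bar> * (1 + \<bar>s\<bar> / 2)"
    unfolding z perturbed_def by (simp only: real_norm_def)
qed

lemma radial_perturbed: "radial (perturbed \<delta> \<tau> \<Lambda> \<eta> \<epsilon> s :: 'a::euclidean_space \<Rightarrow> real)"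
  by (simp add: radial_def perturbed_def two_shells_def bump_def indicator_def)

theorem theorem5:
  assumes "CARD('n::finite) \<ge> 4"
  shows "let \<delta> = 1 / (4 * real CARD('n)) in
    \<exists>\<tau> \<Lambda> \<eta> \<epsilon>\<^sub>0 :: real. \<tau> > 0 \<and> \<Lambda> > 1 + \<tau> \<and> 0 < \<eta> \<and> \<eta> < \<delta> \<and> \<epsilon>\<^sub>0 > 0 \<and>
      (\<forall>\<epsilon>. 0 < \<epsilon> \<and> \<epsilon> \<le> \<epsilon>\<^sub>0 \<longrightarrow>
        (let f = (\<lambda>y :: real ^ 'n. two_shells \<delta> \<tau> \<Lambda> y + \<epsilon> * (exp (- norm y) + bump \<eta> y));
             g = (\<lambda>y :: real ^ 'n. two_shells \<delta> \<tau> \<Lambda> y + \<epsilon> * (exp (- norm y) - bump \<eta> y))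
         in bounded (range f) \<and> bounded (range g) \<and>
            radial f \<and> radial g \<and>
            (\<forall>y. f y > 0) \<and> (\<forall>y. g y > 0) \<and>
            integrable lebesgue f \<and> integrable lebesgue g \<and>
            (\<forall>X. central_maximal f X = central_maximal g X) \<and>
            L1_norm (\<lambda>y. f y - g y) = 2 * \<epsilon> * unit_ball_vol (real CARD('n)) * (\<eta> / 2) ^ CARD('n) \<and>
            2 * \<epsilon> * unit_ball_vol (real CARD('n)) * (\<eta> / 2) ^ CARD('n) > 0))"
proof -
  define \<delta> where "\<delta> = 1 / (4 * real CARD('n))"
  have \<delta>: "0 < \<delta>" "\<delta> \<le> 1 / 16" using assms by (simp_all add: \<delta>_def divide_simps)
  have \<delta>_le: "\<delta> \<le> 1 / (4 * real CARD('n))" by (simp add: \<delta>_def)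
  obtain \<tau> \<Lambda> where shell: "\<tau> > 0" "\<Lambda> > 1 + \<tau>"
    and crit: "\<And>a. 0 < a \<Longrightarrow> a \<le> 1 \<Longrightarrow> \<Lambda> * a \<noteq> 1 \<Longrightarrow>
       annulus_slope CARD('n) \<delta> a + (\<Lambda> + \<tau>) ^ (CARD('n) - 1) * slope CARD('n) ((\<Lambda> + \<tau>) * a)
        - (\<Lambda> - \<tau>) ^ (CARD('n) - 1) * slope CARD('n) ((\<Lambda> - \<tau>) * a) \<noteq> 0"
    by (rule critical_shell[OF assms \<delta>(1) \<delta>_le]) (rule that)
  have improve: "\<exists>r'>0. r' \<noteq> R \<and> shells_avg CARD('n) \<delta> \<tau> \<Lambda> R R < shells_avg CARD('n) \<delta> \<tau> \<Lambda> R r'"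
    if R: "R > 0" for R
    by (rule shells_avg_improve[OF assms \<delta> shell _ R]) (erule (2) crit, blast)
  have card: "CARD('n) \<ge> 2" using assms by simp
  obtain \<rho> where \<rho>: "\<rho> > 0" and gap: "\<And>(X :: real ^ 'n) r. r > 0 \<Longrightarrow> \<bar>r - norm X\<bar> < \<rho> \<Longrightarrow>
    \<exists>r'>0. \<bar>r' - norm X\<bar> \<ge> \<rho> \<and>
      ball_avg (two_shells \<delta> \<tau> \<Lambda>) X r + \<rho> * min 1 (1 / r ^ CARD('n)) \<le> ball_avg (two_shells \<delta> \<tau> \<Lambda>) X r'"
    by (rule ball_avg_gap[OF card \<delta> shell]) (erule improve, rule that)
  obtain C where C: "C > 0" "\<And>(X :: real ^ 'n) r s \<eta>. r > 0 \<Longrightarrow> \<bar>s\<bar> \<le> 1 \<Longrightarrow> 0 < \<eta> \<Longrightarrow> \<eta> \<le> 1 / 16 \<Longrightarrow>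
      ball_avg (\<lambda>y. exp (- norm y) + s * bump \<eta> y) X r \<le> C * min 1 (1 / r ^ CARD('n))"
    by (rule ball_avg_perturbation_le[where 'a="real ^ 'n", unfolded DIM_cart DIM_real mult_1_right]) (rule that)
  \<comment> \<open>With \<open>\<eta> \<le> \<rho>\<close> every radius affected by the bump is in
    the range of \<open>gap\<close>, and the radius \<open>r'\<close> found there is
    unaffected.\<close>
  define \<eta> where "\<eta> = min \<rho> (\<delta> / 2)"
  have \<eta>: "0 < \<eta>" "\<eta> < \<delta>" "\<eta> \<le> 1 / 16" "\<eta> \<le> \<rho>" using \<rho> \<delta> by (auto simp: \<eta>_def)
  \<comment> \<open>Makes the perturbation bound \<open>\<epsilon> * C\<close> at most the gap
    constant \<rho>.\<close>
  define \<epsilon>0 where "\<epsilon>0 = \<rho> / C"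
  have \<epsilon>0: "\<epsilon>0 > 0" using \<rho> C by (simp add: \<epsilon>0_def)
  let ?p = "\<lambda>\<epsilon> s. perturbed \<delta> \<tau> \<Lambda> \<eta> \<epsilon> s :: real ^ 'n \<Rightarrow> real"
  have f: "two_shells \<delta> \<tau> \<Lambda> y + \<epsilon> * (exp (- norm y) + bump \<eta> y) = ?p \<epsilon> 1 y"
    and g: "two_shells \<delta> \<tau> \<Lambda> y + \<epsilon> * (exp (- norm y) - bump \<eta> y) = ?p \<epsilon> (- 1) y" for \<epsilon> y
    by (simp_all add: perturbed_def)
  have main: "bounded (range (?p \<epsilon> 1)) \<and> bounded (range (?p \<epsilon> (- 1))) \<and>
      radial (?p \<epsilon> 1) \<and> radial (?p \<epsilon> (- 1)) \<and> (\<forall>y. ?p \<epsilon> 1 y > 0) \<and> (\<forall>y. ?p \<epsilon> (- 1) y > 0) \<and>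
      integrable lebesgue (?p \<epsilon> 1) \<and> integrable lebesgue (?p \<epsilon> (- 1)) \<and>
      (\<forall>X. central_maximal (?p \<epsilon> 1) X = central_maximal (?p \<epsilon> (- 1)) X) \<and>
      L1_norm (\<lambda>y. ?p \<epsilon> 1 y - ?p \<epsilon> (- 1) y) = 2 * \<epsilon> * unit_ball_vol (real CARD('n)) * (\<eta> / 2) ^ CARD('n) \<and>
      2 * \<epsilon> * unit_ball_vol (real CARD('n)) * (\<eta> / 2) ^ CARD('n) > 0"
    if \<epsilon>: "0 < \<epsilon>" "\<epsilon> \<le> \<epsilon>0" for \<epsilon>
  proof (intro conjI allI bounded_perturbed radial_perturbed integrable_perturbed)
    show "?p \<epsilon> 1 y > 0" "?p \<epsilon> (- 1) y > 0" for y
      using \<eta> \<epsilon> by (auto intro!: perturbed_pos)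
    have "\<epsilon> * C \<le> \<rho>" using \<epsilon> C by (simp add: \<epsilon>0_def field_simps)
    then show "central_maximal (?p \<epsilon> 1) X = central_maximal (?p \<epsilon> (- 1)) X" for X
      using \<eta> \<epsilon> by (intro antisym central_maximal_perturbed_le[OF gap C(2)]) auto
    have "?p \<epsilon> 1 y - ?p \<epsilon> (- 1) y = 2 * \<epsilon> * bump \<eta> y" for y
      by (simp add: perturbed_def algebra_simps)
    then have "\<bar>?p \<epsilon> 1 y - ?p \<epsilon> (- 1) y\<bar> = 2 * \<epsilon> * \<bar>bump \<eta> y\<bar>" for y
      using \<epsilon> by (simp add: abs_mult)
    then show "L1_norm (\<lambda>y. ?p \<epsilon> 1 y - ?p \<epsilon> (- 1) y) = 2 * \<epsilon> * unit_ball_vol (real CARD('n)) * (\<eta> / 2) ^ CARD('n)"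
      using integral_abs_bump[OF \<eta>(1), where 'a="real ^ 'n"] by (simp add: L1_norm_def)
    show "2 * \<epsilon> * unit_ball_vol (real CARD('n)) * (\<eta> / 2) ^ CARD('n) > 0"
      using \<epsilon> \<eta> by simp
  qed
  show ?thesis
    unfolding Let_def \<delta>_def[symmetric]
    by (rule exI[of _ \<tau>], rule exI[of _ \<Lambda>], rule exI[of _ \<eta>], rule exI[of _ \<epsilon>0],
        rule conjI[OF shell(1)], rule conjI[OF shell(2)], rule conjI[OF \<eta>(1)],
        rule conjI[OF \<eta>(2)], rule conjI[OF \<epsilon>0]) (unfold f g, intro allI impI, elim conjE, rule main)
qed

end
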